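(* The Monge-Ampère eigenvalue $\lambda[\cdot]$ has the following properties: (i) (Stability with respect to the Hausdorff convergence) Let $\{\Omega_m\}_{m=1}^\infty\subset\mathbb{R}^n$ be a sequence of open bounded convex domains that converges in the Hausdorff distance to an open bounded convex domain $\Omega$. Then $\lim_{m\to\infty}\lambda[\Omega_m]=\lambda[\Omega]$. (ii) (Domain monotonicity) If $\Omega_1$ and $\Omega_2$ are open bounded convex domains in $\mathbb{R}^n$ such that $\Omega_1\subset\Omega_2$ then $\lambda[\Omega_2]\le\lambda[\Omega_1]$. (iii) (Affine transformation) Let $\Omega$ be an open bounded convex domain in $\mathbb{R}^n$. If $T:\mathbb{R}^n\to\mathbb{R}^n$ is an invertible affine transformation then $\lambda[T(\Omega)]=|\det T|^{-2}\lambda[\Omega]$. In particular, $\lambda[t\Omega]=t^{-2n}\lambda[\Omega]$ for all $t>0$, and $\lambda[T(\Omega)]=\lambda[\Omega]$ if $T$ is an affine transformation with $\det T=1$.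
   Context: The dimension $n\ge2$ is fixed. All bounded open convex domains are assumed to have nonempty interior. $\det T$ denotes the determinant of the linear part of the affine map $T$. For a bounded open convex domain $\Omega\subset\mathbb{R}^n$, the Monge-Ampère eigenvalue is $$\lambda[\Omega]=\inf\left\{\frac{\int_\Omega(-u)\det D^2u\,dx}{\int_\Omega(-u)^{n+1}\,dx}: u\in C(\overline\Omega),\ u \text{ convex, nonzero in }\Omega,\ u=0\text{ on }\partial\Omega\right\}.$$ Here $\det D^2u\,dx$ denotes the Monge-Ampère measure $Mu(E)=|\partial u(E)|$ ($E\subset\Omega$ Borel, $|\cdot|$ Lebesgue measure), where $\partial u(E)=\bigcup_{x\in E}\partial u(x)$ and $\partial u(x)=\{p\in\mathbb{R}^n:u(y)\ge u(x)+p\cdot(y-x)\ \forall y\in\Omega\}$. *)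

theory Defs
  imports "HOL-Analysis.Analysis"
begin

definition bounded_convex_domain :: "(real ^ 'n) set \<Rightarrow> bool" where
  "bounded_convex_domain \<Omega> \<longleftrightarrow> open \<Omega> \<and> bounded \<Omega> \<and> convex \<Omega> \<and> \<Omega> \<noteq> {}"

(* The suprema are meaningful (nonempty, bounded above) for nonempty bounded A and B. *)
definition hausdorff_distance :: "'a::metric_space set \<Rightarrow> 'a set \<Rightarrow> real" where
  "hausdorff_distance A B = max (SUP x\<in>A. infdist x B) (SUP y\<in>B. infdist y A)"

definition subdifferential :: "(real ^ 'n) set \<Rightarrow> (real ^ 'n \<Rightarrow> real) \<Rightarrow> real ^ 'n \<Rightarrow> (real ^ 'n) set" where
  "subdifferential \<Omega> u x = {p. \<forall>y\<in>\<Omega>. u y \<ge> u x + p \<bullet> (y - x)}"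

(* The Borel measure E \<mapsto> |\<partial>u(E)| on \<Omega>, possibly of infinite total mass.
   measure_of yields the zero measure if the given set function is not countably
   additive; by Aleksandrov's theorem this does not occur for \<Omega> open and u convex
   on \<Omega>, where moreover \<partial>u(E) is Lebesgue measurable for every Borel set E. *)
definition monge_ampere_measure :: "(real ^ 'n) set \<Rightarrow> (real ^ 'n \<Rightarrow> real) \<Rightarrow> (real ^ 'n) measure" where
  "monge_ampere_measure \<Omega> u =
     measure_of \<Omega> {E \<in> sets borel. E \<subseteq> \<Omega>}
       (\<lambda>E. emeasure lebesgue (\<Union>x\<in>E. subdifferential \<Omega> u x))"

(* Functions on the closure of \<Omega> are represented by total functions; their values
   outside the closure are irrelevant below. *)
definition ma_admissible :: "(real ^ 'n) set \<Rightarrow> (real ^ 'n \<Rightarrow> real) set" where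
  "ma_admissible \<Omega> =
     {u. continuous_on (closure \<Omega>) u \<and> convex_on \<Omega> u \<and> (\<exists>x\<in>\<Omega>. u x \<noteq> 0) \<and> (\<forall>x\<in>frontier \<Omega>. u x = 0)}"

(* Values in [0, \<infinity>], since the numerator can be infinite. An admissible u is
   nonpositive on \<Omega>, so ennreal does not truncate, and the denominator is
   positive and finite. *)
definition ma_rayleigh_quotient :: "(real ^ 'n) set \<Rightarrow> (real ^ 'n \<Rightarrow> real) \<Rightarrow> ennreal" where
  "ma_rayleigh_quotient \<Omega> u =
     (\<integral>\<^sup>+x. ennreal (- u x) \<partial>monge_ampere_measure \<Omega> u) /
     (\<integral>\<^sup>+x\<in>\<Omega>. ennreal ((- u x) ^ (CARD('n) + 1)) \<partial>lborel)"

definition ma_eigenvalue :: "(real ^ 'n) set \<Rightarrow> ennreal" where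
  "ma_eigenvalue \<Omega> = (INF u\<in>ma_admissible \<Omega>. ma_rayleigh_quotient \<Omega> u)"

end

theory Submission
  imports Defs
begin

text \<open>
  The infimum that defines the eigenvalue is compared between domains directly on competitors. The
  basic idea is to compute the energy \<open>\<integral> (-u) det D\<^sup>2u\<close> on the side of slopes. For a function \<open>u\<close> that is
  continuous on the closure of the domain, almost every slope \<open>p\<close> is that of a supporting affine
  function touching \<open>u\<close> at exactly one point \<open>S p\<close> of the closure (\<open>multiple_legendre_points_null\<close>).
  Hence the Monge-Ampere measure is the image of Lebesgue measure under \<open>S\<close>
  (\<open>monge_ampere_measure_eq_distr\<close>), and if \<open>u\<close> vanishes on the frontier, then the energy is
  the integral of \<open>- u (S p)\<close> over all slopes \<open>p\<close> (\<open>energy_as_slope_integral\<close>).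

  Domain monotonicity (\<open>ma_eigenvalue_antimono\<close>): extend a competitor on the smaller domain by zero and
  take the convex envelope on the larger one. The envelope lies below the extension, so the
  denominator of the Rayleigh quotient does not decrease; and its touching points are touching points
  of the extension (\<open>legendre_points_convex_envelope\<close>), so slope by slope the integrand of the energy
  does not increase. That the envelope is a competitor, in particular continuous up to the frontier with
  value zero, follows from barriers (\<open>frontier_barrier\<close>).

  Under an affine map with linear part \<open>A\<close> the slopes transform by the inverse transpose. The energy is
  therefore divided by \<open>|det A|\<close> while the denominator is multiplied by it, which gives the
  power \<open>-2\<close> (\<open>ma_eigenvalue_affine\<close>). Finally, a domain Hausdorff close to \<open>\<Omega>\<close> lies between
  two dilations of \<open>\<Omega>\<close> about an interior point with factors close to \<open>1\<close>, and stability follows from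
  monotonicity and scaling (\<open>ma_eigenvalue_hausdorff_limit\<close>).
\<close>

section \<open>Slopes and the points where they touch the graph\<close>

text \<open>
  These are the points of \<open>K\<close> where the supremum that defines the Legendre transform of \<open>g\<close> at the
  slope \<open>p\<close> is attained. For a domain with closure \<open>K\<close>, an interior point lies in the set exactly if
  \<open>p\<close> is a subgradient of \<open>g\<close> there, so the map from slopes to points is the inverse of the
  multivalued gradient.
\<close>

definition legendre_points :: "'a::real_inner set \<Rightarrow> ('a \<Rightarrow> real) \<Rightarrow> 'a \<Rightarrow> 'a set" where
  "legendre_points K g p = {x\<in>K. \<forall>y\<in>K. p \<bullet> y - g y \<le> p \<bullet> x - g x}"

lemma legendre_points_nonempty:
  fixes K :: "(real^'n) set"
  assumes "compact K" "K \<noteq> {}" "continuous_on K g"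
  shows "legendre_points K g p \<noteq> {}"
proof -
  have "continuous_on K (\<lambda>y. p \<bullet> y - g y)"
    by (intro continuous_intros assms)
  from continuous_attains_sup[OF assms(1,2) this] show ?thesis
    by (auto simp: legendre_points_def)
qed

lemma legendre_points_monotone:
  assumes "x \<in> legendre_points K g p" "y \<in> legendre_points K g q"
  shows "(p - q) \<bullet> (x - y) \<ge> 0"
proof -
  have "p \<bullet> y - g y \<le> p \<bullet> x - g x" "q \<bullet> x - g x \<le> q \<bullet> y - g y"
    using assms by (auto simp: legendre_points_def)
  then show ?thesis by (simp add: algebra_simps)
qed

text \<open>
  The graph of the relation between slopes and touching points is closed, and a closed set remains
  closed under projection along a compact factor. The Borel measurability of the exceptional slopes
  and of the touching map both come from here.
\<close>

lemma closed_slopes_touching: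
  fixes K :: "(real^'n) set"
  assumes "compact K" "continuous_on K g" "closed C"
  shows "closed {p. legendre_points K g p \<inter> C \<noteq> {}}"
proof -
  \<comment> \<open>Pairs of a point and a slope satisfying the one inequality that belongs to \<open>y\<close>.\<close>
  define Z where "Z y = {z \<in> (K \<inter> C) \<times> (UNIV :: (real^'n) set). snd z \<bullet> y - g y - snd z \<bullet> fst z + g (fst z) \<in> {..0}}" for y
  have KC: "compact (K \<inter> C)" using assms by blast
  have gg: "continuous_on ((K \<inter> C) \<times> (UNIV :: (real^'n) set)) (\<lambda>z. g (fst z))"
    by (rule continuous_on_compose2[OF assms(2)]) (auto intro!: continuous_intros)
  have "closed (Z y)" for y
    unfolding Z_def
    by (rule continuous_closed_preimage[where f = "\<lambda>z. snd z \<bullet> y - g y - snd z \<bullet> fst z + g (fst z)", unfolded vimage_def Int_def, simplified])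
      (use gg assms in \<open>auto intro!: continuous_intros closed_Times simp: compact_imp_closed\<close>)
  then have "closed (((K \<inter> C) \<times> UNIV) \<inter> (\<Inter>y\<in>K. Z y))"
    using assms by (intro closed_Int closed_INT closed_Times ballI) (auto simp: compact_imp_closed)
  from closed_compact_projection[OF KC this]
  have "closed {p. \<exists>x. x \<in> K \<inter> C \<and> (x, p) \<in> ((K \<inter> C) \<times> UNIV) \<inter> (\<Inter>y\<in>K. Z y)}" .
  also have "{p. \<exists>x. x \<in> K \<inter> C \<and> (x, p) \<in> ((K \<inter> C) \<times> UNIV) \<inter> (\<Inter>y\<in>K. Z y)}
     = {p. legendre_points K g p \<inter> C \<noteq> {}}"
    by (auto simp: Z_def legendre_points_def algebra_simps) 
  finally show ?thesis .
qed

text \<open>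
  Averaging over the translates of \<open>C\<close> by \<open>t *\<^sub>R e\<close>, \<open>0 \<le> t \<le> 1\<close>, does not change the measure of \<open>C\<close>.
  By Tonelli the average is also the integral over \<open>p\<close> of the length of a set of at most one \<open>t\<close>.
\<close>

lemma null_set_of_thin_lines:
  fixes C :: "'a::euclidean_space set"
  assumes C: "C \<in> sets borel" and thin: "\<And>p s t. p + s *\<^sub>R e \<in> C \<Longrightarrow> p + t *\<^sub>R e \<in> C \<Longrightarrow> s = t"
  shows "C \<in> null_sets lborel"
proof -
  define I :: "real set" where "I = {0..1}"
  have [measurable]: "C \<in> sets borel" "I \<in> sets borel" using C by (auto simp: I_def)
  have shift: "(\<integral>\<^sup>+p. indicator C (p + t *\<^sub>R e) \<partial>lborel) = emeasure lborel C" for t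
  proof -
    have "emeasure lborel C = (\<integral>\<^sup>+p. indicator C p \<partial>distr lborel borel ((+) (t *\<^sub>R e)))"
      by (simp add: lborel_distr_plus)
    also have "\<dots> = (\<integral>\<^sup>+p. indicator C (t *\<^sub>R e + p) \<partial>lborel)"
      by (rule nn_integral_distr) auto
    finally show ?thesis by (simp add: add.commute)
  qed
  have line: "(\<integral>\<^sup>+t. indicator C (p + t *\<^sub>R e) * indicator I t \<partial>lborel) = 0" for p
  proof -
    have meas: "(\<lambda>t. p + t *\<^sub>R e) \<in> borel_measurable lborel" by measurable
    have "{t. p + t *\<^sub>R e \<in> C} \<subseteq> {SOME t. p + t *\<^sub>R e \<in> C}"
      using thin by (auto intro: someI2)
    then have "countable {t. p + t *\<^sub>R e \<in> C}"
      by (meson countable_finite finite.emptyI finite.insertI finite_subset)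
    then have 0: "emeasure lborel {t. p + t *\<^sub>R e \<in> C} = 0"
      by (rule emeasure_lborel_countable)
    have "(\<integral>\<^sup>+t. indicator C (p + t *\<^sub>R e) * indicator I t \<partial>lborel) \<le> (\<integral>\<^sup>+t. indicator {t. p + t *\<^sub>R e \<in> C} t \<partial>lborel)"
      by (intro nn_integral_mono) (auto simp: indicator_def)
    also have "\<dots> = emeasure lborel {t. p + t *\<^sub>R e \<in> C}"
      using measurable_sets[OF meas, of C] by (intro nn_integral_indicator) (auto simp: vimage_def)
    finally show ?thesis using 0 by simp
  qed
  have "emeasure lborel C = (\<integral>\<^sup>+t. emeasure lborel C * indicator I t \<partial>lborel)"
    by (subst nn_integral_cmult_indicator) (auto simp: I_def)
  also have "\<dots> = (\<integral>\<^sup>+t. \<integral>\<^sup>+p. indicator C (p + t *\<^sub>R e) * indicator I t \<partial>lborel \<partial>lborel)"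
    by (subst nn_integral_multc) (auto simp: shift)
  also have "\<dots> = (\<integral>\<^sup>+p. \<integral>\<^sup>+t. indicator C (p + t *\<^sub>R e) * indicator I t \<partial>lborel \<partial>lborel)"
    by (rule lborel_pair.Fubini') measurable
  also have "\<dots> = 0" by (simp add: line)
  finally show ?thesis using C by (auto simp: null_sets_def)
qed

text \<open>
  Touching points are subgradients of the Legendre transform, so this is its differentiability
  almost everywhere, for which monotonicity of the subgradients suffices. If a slope has two touching
  points, some coordinate of the two is separated by rationals \<open>r < s\<close>. For fixed \<open>i\<close>, \<open>r\<close>, \<open>s\<close>, a line in direction \<open>i\<close> contains at most one such slope, because the \<open>i\<close>-th
  coordinate of touching points does not decrease along the line.
\<close>

lemma multiple_legendre_points_null:
  fixes K :: "(real^'n) set"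
  assumes "compact K" "continuous_on K g"
  shows "{p. \<exists>x\<in>legendre_points K g p. \<exists>y\<in>legendre_points K g p. x \<noteq> y} \<in> null_sets lborel"
proof -
  define L where "L = (\<lambda>(i::'n) (r::real). {p. legendre_points K g p \<inter> {x. x $ i \<le> r} \<noteq> {}})"
  define U where "U = (\<lambda>(i::'n) (s::real). {p. legendre_points K g p \<inter> {x. x $ i \<ge> s} \<noteq> {}})"
  have "closed {x::real^'n. x $ i \<le> r}" "closed {x::real^'n. x $ i \<ge> r}" for i r
    by (auto intro!: closed_Collect_le continuous_intros)
  then have cl: "closed (L i r)" "closed (U i r)" for i r
    unfolding L_def U_def using closed_slopes_touching[OF assms] by blast+
  have null: "L i r \<inter> U i s \<in> null_sets lborel" if "r < s" for i r s
  proof (rule null_set_of_thin_lines[where e = "axis i 1"])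
    show "L i r \<inter> U i s \<in> sets borel" using cl by auto
  next
    have *: False if lt: "a < b" and A: "p + a *\<^sub>R axis i 1 \<in> L i r \<inter> U i s"
      and B: "p + b *\<^sub>R axis i 1 \<in> L i r \<inter> U i s" for p a b
    proof -
      obtain y where y: "y \<in> legendre_points K g (p + a *\<^sub>R axis i 1)" "y $ i \<ge> s" using A by (auto simp: U_def)
      obtain x where x: "x \<in> legendre_points K g (p + b *\<^sub>R axis i 1)" "x $ i \<le> r" using B by (auto simp: L_def)
      have "(b - a) *\<^sub>R axis i 1 \<bullet> (x - y) \<ge> 0"
        using legendre_points_monotone[OF x(1) y(1)] by (simp add: algebra_simps)
      then have "(b - a) * (x $ i - y $ i) \<ge> 0" by (simp add: inner_axis' algebra_simps)
      then show False using lt x y \<open>r < s\<close> by (simp add: zero_le_mult_iff)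
    qed
    show "a = b" if "p + a *\<^sub>R axis i 1 \<in> L i r \<inter> U i s" "p + b *\<^sub>R axis i 1 \<in> L i r \<inter> U i s" for p a b
      using *[of a b p] *[of b a p] that by (meson linorder_neqE)
  qed
  have "{p. \<exists>x\<in>legendre_points K g p. \<exists>y\<in>legendre_points K g p. x \<noteq> y}
      = (\<Union>i\<in>UNIV. \<Union>z\<in>{z\<in>\<rat> \<times> \<rat>. fst z < snd z}. L i (fst z) \<inter> U i (snd z))" (is "?N = ?M")
  proof (intro equalityI subsetI)
    fix p assume "p \<in> ?N"
    then obtain x y where xy: "x \<in> legendre_points K g p" "y \<in> legendre_points K g p" "x \<noteq> y" by auto
    have "\<exists>x\<in>legendre_points K g p. \<exists>y\<in>legendre_points K g p. \<exists>i. x $ i < y $ i"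
      using xy by (metis vec_eq_iff linorder_neqE)
    then obtain x y i where xy: "x \<in> legendre_points K g p" "y \<in> legendre_points K g p" "x $ i < y $ i" by auto
    obtain r where r: "r \<in> \<rat>" "x $ i < r" "r < y $ i" using Rats_dense_in_real[OF xy(3)] by auto
    obtain s where s: "s \<in> \<rat>" "r < s" "s < y $ i" using Rats_dense_in_real[OF r(3)] by auto
    have "p \<in> L i r \<inter> U i s" using xy r s by (force simp: L_def U_def)
    then show "p \<in> ?M" using r s by fastforce
  qed (fastforce simp: L_def U_def)
  moreover have "?M \<in> null_sets lborel"
  proof (intro null_sets_UN' null)
    show "countable {z \<in> \<rat> \<times> \<rat>. fst z < (snd z :: real)}"
      by (rule countable_subset[of _ "\<rat> \<times> \<rat>"]) (auto intro: countable_rat)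
  qed auto
  ultimately show ?thesis by simp
qed

lemma legendre_selection:
  fixes K :: "(real^'n) set"
  assumes "compact K" "K \<noteq> {}" "continuous_on K g"
  obtains S N where "S \<in> borel_measurable borel" "N \<in> null_sets lborel"
    "\<And>p. S p \<in> K" "\<And>p. p \<notin> N \<Longrightarrow> legendre_points K g p = {S p}"
proof -
  obtain a where a: "a \<in> K" using assms by auto
  define N where "N = {p. \<exists>x\<in>legendre_points K g p. \<exists>y\<in>legendre_points K g p. x \<noteq> y}"
  \<comment> \<open>On \<open>N\<close> any constant in \<open>K\<close> will do: it keeps \<open>S\<close> measurable and its values in \<open>K\<close>.\<close>
  define S where "S p = (if p \<in> N then a else the_elem (legendre_points K g p))" for p
  have N: "N \<in> null_sets lborel" unfolding N_def by (rule multiple_legendre_points_null) (use assms in auto)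
  then have NB: "N \<in> sets borel" by auto
  have S: "legendre_points K g p = {S p}" if p: "p \<notin> N" for p
  proof -
    obtain x where x: "x \<in> legendre_points K g p" using legendre_points_nonempty[OF assms] by auto
    then have "legendre_points K g p = {x}" using p by (auto simp: N_def)
    then show ?thesis using p by (simp add: S_def)
  qed
  have "S \<in> borel_measurable borel"
    unfolding borel_eq_closed
  proof (rule measurable_measure_of)
    show "S -` C \<inter> space (sigma UNIV (Collect closed)) \<in> sets (sigma UNIV (Collect closed))"
      if "C \<in> Collect closed" for C
    proof -
      have "S -` C = ({p. legendre_points K g p \<inter> C \<noteq> {}} - N) \<union> (if a \<in> C then N else {})"
      proof (intro set_eqI)
        fix p
        have "p \<notin> N \<Longrightarrow> legendre_points K g p \<inter> C \<noteq> {} \<longleftrightarrow> S p \<in> C" using S[of p] by auto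
        moreover have "p \<in> N \<Longrightarrow> S p = a" by (simp add: S_def)
        ultimately show "p \<in> S -` C \<longleftrightarrow>
            p \<in> ({p. legendre_points K g p \<inter> C \<noteq> {}} - N) \<union> (if a \<in> C then N else {})"
          by auto
      qed
      also have "\<dots> \<in> sets borel"
        using closed_slopes_touching[OF assms(1,3), of C] that NB by auto
      finally show ?thesis by (simp flip: borel_eq_closed)
    qed
  qed (auto simp flip: borel_eq_closed)
  moreover have "S p \<in> K" for p
    using a S[of p] by (cases "p \<in> N") (auto simp: S_def legendre_points_def)
  ultimately show thesis using that N S by blast
qed

section \<open>The Monge-Ampere measure as an image of Lebesgue measure\<close>

lemma subdifferential_eq_legendre:
  assumes u: "continuous_on (closure \<Omega>) u" and x: "x \<in> \<Omega>"
  shows "p \<in> subdifferential \<Omega> u x \<longleftrightarrow> x \<in> legendre_points (closure \<Omega>) u p"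
proof
  assume p: "p \<in> subdifferential \<Omega> u x"
  have "p \<bullet> y - u y \<le> p \<bullet> x - u x" if "y \<in> closure \<Omega>" for y
  proof (rule continuous_le_on_closure[where S = \<Omega> and f = "\<lambda>y. p \<bullet> y - u y"])
    show "continuous_on (closure \<Omega>) (\<lambda>y. p \<bullet> y - u y)" by (intro continuous_intros u)
    show "p \<bullet> y - u y \<le> p \<bullet> x - u x" if "y \<in> \<Omega>" for y
      using p that by (auto simp: subdifferential_def algebra_simps)
  qed fact
  then show "x \<in> legendre_points (closure \<Omega>) u p"
    using x closure_subset by (auto simp: legendre_points_def)
next
  assume "x \<in> legendre_points (closure \<Omega>) u p"
  then have "\<forall>y\<in>\<Omega>. p \<bullet> y - u y \<le> p \<bullet> x - u x" using closure_subset by (auto simp: legendre_points_def)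
  then show "p \<in> subdifferential \<Omega> u x" by (auto simp: subdifferential_def algebra_simps)
qed

text \<open>
  Outside a null set a slope touches at exactly one point of the closure, so \<open>|\<partial>u(E)|\<close> is the
  measure of the preimage of \<open>E\<close> under the touching map. Countable additivity (the theorem of
  Aleksandrov) and measurability of \<open>\<partial>u(E)\<close> are consequences of this description.
\<close>

lemma monge_ampere_measure_eq_distr:
  assumes \<Omega>: "open \<Omega>" and u: "continuous_on (closure \<Omega>) u"
    and S: "S \<in> borel_measurable borel" and N: "N \<in> null_sets lborel"
    and sel: "\<And>p. p \<notin> N \<Longrightarrow> legendre_points (closure \<Omega>) u p = {S p}"
  shows "monge_ampere_measure \<Omega> u = restrict_space (distr lborel borel S) \<Omega>"
proof -
  have sets_eq: "(\<inter>) \<Omega> ` sets borel = {E \<in> sets borel. E \<subseteq> \<Omega>}"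
  proof (intro equalityI subsetI)
    fix E assume "E \<in> {E \<in> sets borel. E \<subseteq> \<Omega>}"
    then have "E \<in> sets borel" "E = \<Omega> \<inter> E" by auto
    then show "E \<in> (\<inter>) \<Omega> ` sets borel" by (rule rev_image_eqI)
  qed (use \<Omega> in auto)
  have eq: "emeasure lebesgue (\<Union>x\<in>E. subdifferential \<Omega> u x) = emeasure (distr lborel borel S) E"
    if E: "E \<in> sets borel" "E \<subseteq> \<Omega>" for E
  proof -
    have N': "negligible N" "N \<in> null_sets lebesgue"
      using N by (auto simp: negligible_iff_null_sets null_sets_completionI)
    have SE: "S -` E \<in> sets borel" using measurable_sets[OF S E(1)] by simp
    let ?D = "\<Union>x\<in>E. subdifferential \<Omega> u x"
    have D: "p \<in> ?D \<longleftrightarrow> legendre_points (closure \<Omega>) u p \<inter> E \<noteq> {}" for p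
      using subdifferential_eq_legendre[OF u] E(2) by blast
    then have out: "p \<in> ?D \<longleftrightarrow> p \<in> S -` E" if "p \<notin> N" for p
      using sel[OF that] by auto
    have SL: "S -` E \<in> sets lebesgue" using SE by (simp add: sets_completionI_sets)
    have neg: "negligible ((S -` E - ?D) \<union> (?D - S -` E))"
      by (rule negligible_subset[OF N'(1)]) (use out in blast)
    have DL: "?D \<in> sets lebesgue" by (rule sets_negligible_symdiff[OF SL neg])
    have "emeasure lebesgue ?D = emeasure lebesgue (S -` E)"
    proof (rule emeasure_eq_AE)
      show "AE p in lebesgue. (p \<in> ?D) = (p \<in> S -` E)"
        by (rule AE_I'[OF N'(2)]) (use out in blast)
    qed (fact DL SL)+
    also have "\<dots> = emeasure lborel (S -` E)" using SE by simp
    also have "\<dots> = emeasure (distr lborel borel S) E" using S E by (simp add: emeasure_distr)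
    finally show ?thesis .
  qed
  have alg: "sigma_sets \<Omega> {E \<in> sets borel. E \<subseteq> \<Omega>} = {E \<in> sets borel. E \<subseteq> \<Omega>}"
    using sets.sigma_sets_eq[of "restrict_space borel \<Omega>"] sets_eq
    by (simp add: sets_restrict_space space_restrict_space)
  have "measure_of \<Omega> {E \<in> sets borel. E \<subseteq> \<Omega>} (\<lambda>E. emeasure lebesgue (\<Union>x\<in>E. subdifferential \<Omega> u x))
      = measure_of \<Omega> {E \<in> sets borel. E \<subseteq> \<Omega>} (emeasure (distr lborel borel S))"
  proof (rule measure_of_eq)
    fix E assume "E \<in> sigma_sets \<Omega> {E \<in> sets borel. E \<subseteq> \<Omega>}"
    then have "E \<in> sets borel" "E \<subseteq> \<Omega>" by (simp_all only: alg mem_Collect_eq)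
    then show "emeasure lebesgue (\<Union>x\<in>E. subdifferential \<Omega> u x) = emeasure (distr lborel borel S) E" by (rule eq)
  qed blast
  then show ?thesis
    unfolding monge_ampere_measure_def restrict_space_def by (simp add: sets_eq)
qed

lemma measurable_cut_off:
  fixes f :: "'a::euclidean_space \<Rightarrow> real"
  assumes "open \<Omega>" "continuous_on \<Omega> f"
  shows "(\<lambda>x. ennreal (f x) * indicator \<Omega> x) \<in> borel_measurable borel"
proof -
  have "(\<lambda>x. indicator \<Omega> x *\<^sub>R f x) \<in> borel_measurable borel"
    using assms by (intro borel_measurable_continuous_on_indicator) auto
  then have "(\<lambda>x. ennreal (indicator \<Omega> x *\<^sub>R f x)) \<in> borel_measurable borel" by measurable
  also have "(\<lambda>x. ennreal (indicator \<Omega> x *\<^sub>R f x)) = (\<lambda>x. ennreal (f x) * indicator \<Omega> x)"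
    by (auto simp: indicator_def)
  finally show ?thesis .
qed

text \<open>
  The numerator of the Rayleigh quotient becomes an integral over all slopes. The slopes that touch
  on the frontier contribute nothing because \<open>u\<close> vanishes there, so the domain disappears from
  the integral and energies on different domains can be compared slope by slope.
\<close>

lemma energy_as_slope_integral:
  fixes u :: "real^'n \<Rightarrow> real"
  assumes \<Omega>: "open \<Omega>" "bounded \<Omega>" "\<Omega> \<noteq> {}" and u: "continuous_on (closure \<Omega>) u" "\<And>x. x \<in> frontier \<Omega> \<Longrightarrow> u x = 0"
  obtains S N where "N \<in> null_sets lborel"
    "\<And>p. p \<notin> N \<Longrightarrow> legendre_points (closure \<Omega>) u p = {S p}"
    "(\<lambda>p. ennreal (- u (S p))) \<in> borel_measurable borel"
    "(\<integral>\<^sup>+x. ennreal (- u x) \<partial>monge_ampere_measure \<Omega> u) = (\<integral>\<^sup>+p. ennreal (- u (S p)) \<partial>lborel)"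
proof -
  have "compact (closure \<Omega>)" "closure \<Omega> \<noteq> {}" using \<Omega> by auto
  from legendre_selection[OF this u(1)] obtain S N where
    S: "S \<in> borel_measurable borel" "N \<in> null_sets lborel" "\<And>p. S p \<in> closure \<Omega>"
    "\<And>p. p \<notin> N \<Longrightarrow> legendre_points (closure \<Omega>) u p = {S p}" by metis
  have eq: "ennreal (- u (S p)) * indicator \<Omega> (S p) = ennreal (- u (S p))" for p
    using S(3)[of p] u(2)[of "S p"] \<Omega>(1) by (auto simp: indicator_def frontier_def interior_open)
  have meas: "(\<lambda>x. ennreal (- u x) * indicator \<Omega> x) \<in> borel_measurable borel"
    by (intro measurable_cut_off \<Omega>(1) continuous_intros continuous_on_subset[OF u(1)] closure_subset)
  have 1: "(\<lambda>p. ennreal (- u (S p))) \<in> borel_measurable borel"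
    using measurable_compose[OF S(1) meas] by (simp add: eq)
  have "(\<integral>\<^sup>+x. ennreal (- u x) \<partial>monge_ampere_measure \<Omega> u)
      = (\<integral>\<^sup>+x. ennreal (- u x) * indicator \<Omega> x \<partial>distr lborel borel S)"
    using \<Omega> by (simp add: nn_integral_restrict_space monge_ampere_measure_eq_distr[OF \<Omega>(1) u(1) S(1,2,4)])
  also have "\<dots> = (\<integral>\<^sup>+p. ennreal (- u (S p)) * indicator \<Omega> (S p) \<partial>lborel)"
    by (rule nn_integral_distr) (use S meas in auto)
  finally show thesis using that S 1 by (simp add: eq)
qed

section \<open>Affine changes of variables\<close>

text \<open>
  A nonsingular map is a product of coordinate stretches, transpositions and shears. The determinant
  of a shear is read off from a row operation rather than from triangularity, since an unordered
  index type has no triangular matrices; \<open>measure_linear_image\<close> is the case of an ordered one.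
\<close>

lemma measure_linear_image_finite_index:
  fixes f :: "real^'n \<Rightarrow> real^'n"
  assumes "linear f" "det (matrix f) \<noteq> 0" "S \<in> lmeasurable"
  shows "f ` S \<in> lmeasurable \<and> measure lebesgue (f ` S) = \<bar>det (matrix f)\<bar> * measure lebesgue S"
proof -
  have "det (matrix f) \<noteq> 0 \<longrightarrow> (\<forall>S\<in>lmeasurable. f ` S \<in> lmeasurable \<and>
      measure lebesgue (f ` S) = \<bar>det (matrix f)\<bar> * measure lebesgue S)"
  proof (rule induct_linear_elementary[OF \<open>linear f\<close>]; intro impI ballI)
    fix f g :: "real^'n \<Rightarrow> real^'n" and S :: "(real^'n) set"
    assume lin: "linear f" "linear g" and S: "S \<in> lmeasurable" and det: "det (matrix (f \<circ> g)) \<noteq> 0"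
      and f: "det (matrix f) \<noteq> 0 \<longrightarrow> (\<forall>S\<in>lmeasurable. f ` S \<in> lmeasurable \<and>
        measure lebesgue (f ` S) = \<bar>det (matrix f)\<bar> * measure lebesgue S)"
      and g: "det (matrix g) \<noteq> 0 \<longrightarrow> (\<forall>S\<in>lmeasurable. g ` S \<in> lmeasurable \<and>
        measure lebesgue (g ` S) = \<bar>det (matrix g)\<bar> * measure lebesgue S)"
    have m: "det (matrix (f \<circ> g)) = det (matrix f) * det (matrix g)"
      using matrix_compose[OF lin(2,1)] by (simp add: det_mul)
    then have nz: "det (matrix f) \<noteq> 0" "det (matrix g) \<noteq> 0" using det by auto
    have gS: "g ` S \<in> lmeasurable" "measure lebesgue (g ` S) = \<bar>det (matrix g)\<bar> * measure lebesgue S"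
      using g nz S by auto
    show "(f \<circ> g) ` S \<in> lmeasurable \<and>
        measure lebesgue ((f \<circ> g) ` S) = \<bar>det (matrix (f \<circ> g))\<bar> * measure lebesgue S"
      using f[rule_format, OF nz(1) gS(1)] unfolding m gS(2) image_comp by (simp add: abs_mult)
  next
    fix f :: "real^'n \<Rightarrow> real^'n" and i and S :: "(real^'n) set"
    assume "\<And>x. f x $ i = 0" and det: "det (matrix f) \<noteq> 0"
    then have "row i (matrix f) = 0" by (simp add: row_def matrix_def vec_eq_iff)
    then have "det (matrix f) = 0" by (rule det_zero_row)
    then show "f ` S \<in> lmeasurable \<and> measure lebesgue (f ` S) = \<bar>det (matrix f)\<bar> * measure lebesgue S"
      using det by simp
  next
    fix c :: "'n \<Rightarrow> real" and S :: "(real^'n) set" assume S: "S \<in> lmeasurable"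
    have "det (matrix (\<lambda>x::real^'n. \<chi> i. c i * x $ i)) = prod c UNIV"
      by (subst det_diagonal) (auto simp: matrix_def axis_def)
    then show "(\<lambda>x. \<chi> i. c i * x $ i) ` S \<in> lmeasurable \<and>
        measure lebesgue ((\<lambda>x. \<chi> i. c i * x $ i) ` S)
        = \<bar>det (matrix (\<lambda>x::real^'n. \<chi> i. c i * x $ i))\<bar> * measure lebesgue S"
      using measurable_stretch[OF S, of c] measure_stretch[OF S, of c] by simp
  next
    fix m n :: 'n and S :: "(real^'n) set" assume mn: "m \<noteq> n" and S: "S \<in> lmeasurable"
    let ?t = "Transposition.transpose m n"
    let ?h = "\<lambda>x::real^'n. \<chi> i. x $ ?t i"
    have lin: "linear ?h" by (rule linearI) (simp_all add: vec_eq_iff)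
    have "matrix ?h = (\<chi> i. (mat 1 :: real^'n^'n) $ ?t i)"
      by (auto simp: matrix_def mat_def axis_def vec_eq_iff)
    then have det: "\<bar>det (matrix ?h)\<bar> = 1"
      by (simp add: det_permute_rows permutes_swap_id sign_swap_id abs_mult)
    have box: "measure lebesgue (?h ` cbox a b) = 1 * measure lebesgue (cbox a b)" for a b
    proof -
      have "?h ` cbox a b = cbox (?h a) (?h b)"
      proof (intro equalityI subsetI)
        fix y assume y: "y \<in> cbox (?h a) (?h b)"
        have "?h y \<in> cbox a b"
          unfolding mem_box_cart
        proof
          fix i show "a $ i \<le> ?h y $ i \<and> ?h y $ i \<le> b $ i"
            using y[unfolded mem_box_cart, rule_format, of "?t i"] by simp
        qed
        then show "y \<in> ?h ` cbox a b" by (rule rev_image_eqI) (simp add: vec_eq_iff)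
      qed (auto simp: mem_box_cart)
      moreover have "(\<Prod>i\<in>UNIV. b $ ?t i - a $ ?t i) = (\<Prod>i\<in>UNIV. b $ i - a $ i)"
        using prod.permute[OF permutes_swap_id[of m UNIV n], of "\<lambda>i. b $ i - a $ i"] by (simp add: o_def)
      moreover have "cbox (?h a) (?h b) = {} \<longleftrightarrow> cbox a b = {}"
        using calculation(1) by auto
      ultimately show ?thesis by (simp add: content_cbox_if_cart)
    qed
    show "?h ` S \<in> lmeasurable \<and> measure lebesgue (?h ` S) = \<bar>det (matrix ?h)\<bar> * measure lebesgue S"
      using measure_linear_sufficient[OF lin S box] det by simp
  next
    fix m n :: 'n and S :: "(real^'n) set" assume mn: "m \<noteq> n" and S: "S \<in> lmeasurable"
    let ?h = "\<lambda>x::real^'n. \<chi> i. if i = m then x $ m + x $ n else x $ i"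
    have lin: "linear ?h" by (rule linearI) (auto simp: vec_eq_iff algebra_simps)
    have "matrix ?h = (\<chi> k. if k = m then row m (mat 1) + 1 *s row n (mat 1) else row k (mat 1))"
      by (auto simp: matrix_def mat_def row_def axis_def vec_eq_iff)
    then have det: "det (matrix ?h) = 1"
      using det_row_operation[OF mn, of "mat 1" "1::real"] by simp
    have box: "measure lebesgue (?h ` cbox a b) = 1 * measure lebesgue (cbox a b)" for a b
    proof (cases "cbox a b = {}")
      case False
      \<comment> \<open>A translation moves the box to one with \<open>a $ n = 0\<close>, to which \<open>measure_shear_interval\<close> applies.\<close>
      let ?v = "axis n (- (a $ n))"
      have "measure lebesgue (?h ` cbox a b) = measure lebesgue ((+) (?h ?v) ` ?h ` cbox a b)"
        by (simp add: measure_translation)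
      also have "(+) (?h ?v) ` ?h ` cbox a b = ?h ` (+) ?v ` cbox a b"
        by (simp add: image_image flip: linear_add[OF lin])
      also have "(+) ?v ` cbox a b = cbox (?v + a) (?v + b)" by (simp add: cbox_translation)
      also have "measure lebesgue (?h ` \<dots>) = measure lebesgue (cbox (?v + a) (?v + b))"
        by (rule measure_shear_interval[OF mn]) (use False in \<open>auto simp: interval_ne_empty_cart\<close>)
      also have "\<dots> = measure lebesgue (cbox a b)"
        by (metis cbox_translation measure_translation)
      finally show ?thesis by simp
    qed simp
    show "?h ` S \<in> lmeasurable \<and> measure lebesgue (?h ` S) = \<bar>det (matrix ?h)\<bar> * measure lebesgue S"
      using measure_linear_sufficient[OF lin S box] det by simp
  qed
  then show ?thesis using assms by blast
qed

lemma lborel_eq_density_distr_affine: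
  fixes A :: "real^'n^'n"
  assumes A: "invertible A"
  shows "lborel = density (distr lborel borel (\<lambda>x. A *v x + b)) (\<lambda>_. ennreal \<bar>det A\<bar>)"
proof (rule lborel_eqI)
  let ?T = "\<lambda>x. A *v x + b"
  have T: "?T \<in> borel_measurable borel"
    by (intro borel_measurable_continuous_onI continuous_intros matrix_vector_mult_linear_continuous_on)
  obtain B where B: "A ** B = mat 1" "B ** A = mat 1" using A by (auto simp: invertible_def)
  have AB: "A *v (B *v x) = x" "B *v (A *v x) = x" for x by (simp_all add: matrix_vector_mul_assoc B)
  show "sets (density (distr lborel borel ?T) (\<lambda>_. ennreal \<bar>det A\<bar>)) = sets borel" by simp
  fix l u :: "real^'n" assume lu: "\<And>i. i \<in> Basis \<Longrightarrow> l \<bullet> i \<le> u \<bullet> i"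
  let ?P = "?T -` box l u"
  have PB: "?P \<in> sets borel" using measurable_sets[OF T, of "box l u"] by simp
  have "?P = (\<lambda>x. B *v (x - b)) ` box l u"
  proof (intro equalityI subsetI)
    fix x assume "x \<in> ?P"
    then show "x \<in> (\<lambda>x. B *v (x - b)) ` box l u"
      by (intro image_eqI[of _ _ "A *v x + b"]) (auto simp: AB)
  qed (auto simp: AB)
  also have "\<dots> = (*v) B ` ((\<lambda>x. x - b) ` box l u)" by (simp add: image_image)
  finally have "bounded ?P"
    by (simp add: bounded_linear_image bounded_translation_minus linear_linear)
  then have P: "?P \<in> lmeasurable" using PB by (intro bounded_set_imp_lmeasurable) auto
  have img: "(*v) A ` ?P = (\<lambda>x. x - b) ` box l u"
  proof (intro equalityI subsetI)
    fix y assume "y \<in> (*v) A ` ?P"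
    then obtain x where "y = A *v x" "A *v x + b \<in> box l u" by auto
    then show "y \<in> (\<lambda>x. x - b) ` box l u" by (intro image_eqI[of _ _ "A *v x + b"]) auto
  next
    fix y assume "y \<in> (\<lambda>x. x - b) ` box l u"
    then have "y + b \<in> box l u" by auto
    then show "y \<in> (*v) A ` ?P" by (intro image_eqI[of _ _ "B *v y"]) (auto simp: AB)
  qed
  have "\<bar>det A\<bar> * measure lebesgue ?P = measure lebesgue ((*v) A ` ?P)"
    using measure_linear_image_finite_index[OF matrix_vector_mul_linear _ P, of A] A by (simp add: invertible_det_nz)
  also have "\<dots> = measure lebesgue (box l u)"
    unfolding img by (rule measure_translation_subtract)
  finally have eq: "\<bar>det A\<bar> * measure lebesgue ?P = measure lebesgue (box l u)" .
  have "emeasure (density (distr lborel borel ?T) (\<lambda>_. ennreal \<bar>det A\<bar>)) (box l u)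
      = ennreal \<bar>det A\<bar> * emeasure lborel ?P"
    using T by (simp add: emeasure_density_const emeasure_distr)
  also have "emeasure lborel ?P = ennreal (measure lebesgue ?P)"
    using emeasure_eq_measure2[OF P] PB by simp
  also have "ennreal \<bar>det A\<bar> * \<dots> = ennreal (measure lebesgue (box l u))"
    by (simp add: eq flip: ennreal_mult)
  also have "\<dots> = ennreal (\<Prod>i\<in>Basis. (u - l) \<bullet> i)"
    using lu by (simp add: measure_lborel_box)
  finally show "emeasure (density (distr lborel borel ?T) (\<lambda>_. ennreal \<bar>det A\<bar>)) (box l u)
     = ennreal (\<Prod>i\<in>Basis. (u - l) \<bullet> i)" .
qed

lemma nn_integral_affine_substitution:
  fixes A :: "real^'n^'n"
  assumes A: "invertible A" and F: "F \<in> borel_measurable borel"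
  shows "(\<integral>\<^sup>+y. F y \<partial>lborel) = ennreal \<bar>det A\<bar> * (\<integral>\<^sup>+x. F (A *v x + b) \<partial>lborel)"
proof -
  have T: "(\<lambda>x. A *v x + b) \<in> borel_measurable borel"
    by (intro borel_measurable_continuous_onI continuous_intros matrix_vector_mult_linear_continuous_on)
  have "(\<integral>\<^sup>+y. F y \<partial>lborel) = (\<integral>\<^sup>+y. F y \<partial>density (distr lborel borel (\<lambda>x. A *v x + b)) (\<lambda>_. ennreal \<bar>det A\<bar>))"
    using lborel_eq_density_distr_affine[OF A, of b] by simp
  also have "\<dots> = ennreal \<bar>det A\<bar> * (\<integral>\<^sup>+x. F (A *v x + b) \<partial>lborel)"
    using T F by (simp add: nn_integral_density nn_integral_cmult nn_integral_distr)
  finally show ?thesis .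
qed

lemma linear_preimage_null_set:
  fixes A :: "real^'n^'n"
  assumes A: "invertible A" and N: "N \<in> null_sets lborel"
  shows "(\<lambda>x. A *v x) -` N \<in> null_sets lborel"
proof -
  have T: "(\<lambda>x. A *v x) \<in> borel_measurable borel"
    by (intro borel_measurable_continuous_onI matrix_vector_mult_linear_continuous_on)
  have NB: "N \<in> sets borel" using N by auto
  have P: "(*v) A -` N \<in> sets borel" using measurable_sets[OF T NB] by simp
  have "0 = (\<integral>\<^sup>+y. indicator N y \<partial>lborel)" using N NB by auto
  also have "\<dots> = ennreal \<bar>det A\<bar> * (\<integral>\<^sup>+x. indicator N (A *v x + 0) \<partial>lborel)"
    by (rule nn_integral_affine_substitution[OF A]) (use NB in simp)
  also have "(\<integral>\<^sup>+x. indicator N (A *v x + 0) \<partial>lborel) = (\<integral>\<^sup>+x. indicator ((*v) A -` N) x \<partial>lborel)"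
    by (simp add: indicator_def)
  also have "\<dots> = emeasure lborel ((*v) A -` N)" using P by simp
  finally show ?thesis
    using A P by (auto simp: null_sets_def invertible_det_nz)
qed

section \<open>Convex envelopes\<close>

text \<open>
  A segment through \<open>x\<close> meets the frontier at both ends; convexity is used on the slightly shortened
  segments, which stay inside the domain, and continuity up to the closure gives the limit.
\<close>

lemma convex_nonpos_if_zero_on_frontier:
  fixes u :: "'a::euclidean_space \<Rightarrow> real"
  assumes \<Omega>: "open \<Omega>" "bounded \<Omega>" and u: "continuous_on (closure \<Omega>) u" "convex_on \<Omega> u"
    "\<And>x. x \<in> frontier \<Omega> \<Longrightarrow> u x = 0" and x: "x \<in> \<Omega>"
  shows "u x \<le> 0"
proof -
  obtain e :: 'a where e: "e \<noteq> 0" using nonzero_Basis SOME_Basis by blast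
  have xi: "x \<in> interior \<Omega>" using x \<Omega> by (simp add: interior_open)
  obtain d where d: "0 < d" "x + d *\<^sub>R e \<in> frontier \<Omega>" "\<And>s. 0 \<le> s \<Longrightarrow> s < d \<Longrightarrow> x + s *\<^sub>R e \<in> interior \<Omega>"
    using ray_to_frontier[OF \<Omega>(2) xi e] by metis
  obtain d' where d': "0 < d'" "x + d' *\<^sub>R (- e) \<in> frontier \<Omega>"
    "\<And>s. 0 \<le> s \<Longrightarrow> s < d' \<Longrightarrow> x + s *\<^sub>R (- e) \<in> interior \<Omega>"
    using ray_to_frontier[OF \<Omega>(2) xi, of "- e"] e by (metis neg_equal_0_iff_equal)
  \<comment> \<open>The weight that makes \<open>x\<close> the barycentre of the two ends.\<close>
  define w where "w = d' / (d + d')"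
  have w: "0 < w" "w < 1" using d(1) d'(1) by (auto simp: w_def field_simps)
  define F where "F s = w * u (x + (s * d) *\<^sub>R e) + (1 - w) * u (x + (s * d') *\<^sub>R (- e))" for s :: real
  have ins: "x + (s * d) *\<^sub>R e \<in> \<Omega>" "x + (s * d') *\<^sub>R (- e) \<in> \<Omega>" if "0 \<le> s" "s < 1" for s
    using that d(3)[of "s * d"] d'(3)[of "s * d'"] d(1) d'(1) \<Omega>(1) by (auto simp: interior_open)
  have below: "u x \<le> F s" if s: "0 \<le> s" "s < 1" for s
  proof -
    have "w * d = (1 - w) * d'" using d(1) d'(1) by (simp add: w_def field_simps)
    then have "(w * (s * d)) *\<^sub>R e = ((1 - w) * (s * d')) *\<^sub>R e" by (simp add: mult.left_commute)
    then have "x = w *\<^sub>R (x + (s * d) *\<^sub>R e) + (1 - w) *\<^sub>R (x + (s * d') *\<^sub>R (- e))"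
      by (simp add: scaleR_add_right algebra_simps)
    then show ?thesis
      using convex_onD[OF u(2), of "1 - w" "x + (s * d) *\<^sub>R e" "x + (s * d') *\<^sub>R (- e)"] ins[OF s] w
      by (simp add: F_def)
  qed
  have cl: "x + (s * d) *\<^sub>R e \<in> closure \<Omega>" "x + (s * d') *\<^sub>R (- e) \<in> closure \<Omega>" if "s \<in> {0..1}" for s
  proof -
    have "x + (s * d) *\<^sub>R e \<in> closure \<Omega> \<and> x + (s * d') *\<^sub>R (- e) \<in> closure \<Omega>"
    proof (cases "s = 1")
      case True then show ?thesis using d(2) d'(2) by (simp add: frontier_def)
    next
      case False then show ?thesis using ins[of s] that closure_subset[of \<Omega>] by auto
    qed
    then show "x + (s * d) *\<^sub>R e \<in> closure \<Omega>" "x + (s * d') *\<^sub>R (- e) \<in> closure \<Omega>" by auto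
  qed
  have "continuous_on {0..1} F"
    unfolding F_def by (intro continuous_intros continuous_on_compose2[OF u(1)]) (use cl in auto)
  then have "continuous_on (closure {0..<1}) F" by simp
  then have "u x \<le> F 1"
    using continuous_ge_on_closure[of "{0..<1}" F 1 "u x"] below by simp
  then show ?thesis using d(2) d'(2) u(3) by (simp add: F_def)
qed

definition affine_minorants :: "'a::real_inner set \<Rightarrow> ('a \<Rightarrow> real) \<Rightarrow> ('a \<times> real) set" where
  "affine_minorants K g = {(p, c). \<forall>y\<in>K. p \<bullet> y + c \<le> g y}"

definition convex_envelope :: "'a::real_inner set \<Rightarrow> ('a \<Rightarrow> real) \<Rightarrow> 'a \<Rightarrow> real" where
  "convex_envelope K g x = (SUP (p, c)\<in>affine_minorants K g. p \<bullet> x + c)"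

lemma affine_minorants_bdd_above:
  assumes "x \<in> K"
  shows "bdd_above ((\<lambda>(p, c). p \<bullet> x + c) ` affine_minorants K g)"
  using assms by (intro bdd_aboveI[where M = "g x"]) (auto simp: affine_minorants_def)

lemma affine_minorants_nonempty:
  fixes g :: "'a::euclidean_space \<Rightarrow> real"
  assumes "compact K" "continuous_on K g"
  shows "affine_minorants K g \<noteq> {}"
proof (cases "K = {}")
  case True
  then show ?thesis by (auto simp: affine_minorants_def)
next
  case False
  then obtain z where "\<And>y. y \<in> K \<Longrightarrow> g z \<le> g y" using continuous_attains_inf assms by metis
  then have "(0, g z) \<in> affine_minorants K g" by (auto simp: affine_minorants_def)
  then show ?thesis by blast
qed

lemma affine_minorant_le_convex_envelope:
  assumes "(p, c) \<in> affine_minorants K g" "x \<in> K"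
  shows "p \<bullet> x + c \<le> convex_envelope K g x"
  unfolding convex_envelope_def
  by (rule cSUP_upper2[OF affine_minorants_bdd_above[OF assms(2)] assms(1)]) simp

lemma convex_envelope_least:
  assumes "affine_minorants K g \<noteq> {}" "\<And>p c. (p, c) \<in> affine_minorants K g \<Longrightarrow> p \<bullet> x + c \<le> z"
  shows "convex_envelope K g x \<le> z"
  unfolding convex_envelope_def by (rule cSUP_least) (use assms in auto)

lemma convex_envelope_le:
  assumes "affine_minorants K g \<noteq> {}" "x \<in> K"
  shows "convex_envelope K g x \<le> g x"
  by (rule convex_envelope_least[OF assms(1)]) (use assms in \<open>auto simp: affine_minorants_def\<close>)

lemma convex_on_convex_envelope:
  assumes "affine_minorants K g \<noteq> {}" "convex K"
  shows "convex_on K (convex_envelope K g)"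
proof (rule convex_onI)
  fix t x y assume t: "0 < t" "t < (1::real)" and xy: "x \<in> K" "y \<in> K"
  show "convex_envelope K g ((1 - t) *\<^sub>R x + t *\<^sub>R y) \<le> (1 - t) * convex_envelope K g x + t * convex_envelope K g y"
  proof (rule convex_envelope_least[OF assms(1)])
    fix p c assume pc: "(p, c) \<in> affine_minorants K g"
    have "p \<bullet> ((1 - t) *\<^sub>R x + t *\<^sub>R y) + c = (1 - t) * (p \<bullet> x + c) + t * (p \<bullet> y + c)"
      by (simp add: algebra_simps)
    also have "\<dots> \<le> (1 - t) * convex_envelope K g x + t * convex_envelope K g y"
      using affine_minorant_le_convex_envelope[OF pc] xy t by (intro add_mono mult_left_mono) auto
    finally show "p \<bullet> ((1 - t) *\<^sub>R x + t *\<^sub>R y) + c \<le> \<dots>" .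
  qed
qed (fact assms)

text \<open>
  The affine function with slope \<open>p\<close> that touches \<open>g\<close> at \<open>x\<close> is a minorant of \<open>g\<close>, hence lies below
  the envelope as well. So passing to the envelope keeps all touching points; for almost every slope,
  which has only one, it does not create new ones. This is why the Monge-Ampere measure of the
  envelope lives on the contact set.
\<close>

lemma legendre_points_convex_envelope:
  assumes ne: "affine_minorants K g \<noteq> {}" and x: "x \<in> legendre_points K g p"
  shows "convex_envelope K g x = g x" "x \<in> legendre_points K (convex_envelope K g) p"
proof -
  have xK: "x \<in> K" using x by (simp add: legendre_points_def)
  have pc: "(p, g x - p \<bullet> x) \<in> affine_minorants K g"
    using x by (auto simp: legendre_points_def affine_minorants_def algebra_simps)
  note le = affine_minorant_le_convex_envelope[OF pc]
  show eq: "convex_envelope K g x = g x"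
    using le[OF xK] convex_envelope_le[OF ne xK] by simp
  show "x \<in> legendre_points K (convex_envelope K g) p"
    using le xK by (auto simp: legendre_points_def eq algebra_simps)
qed

text \<open>
  The barrier is \<open>- e\<close> minus a large multiple of the distance to a supporting hyperplane at \<open>x0\<close>.
  The hyperplane may meet the closure in a whole face, but this face lies in the frontier, where
  \<open>g = 0\<close>. So the set where \<open>g \<le> - e\<close> is compact and disjoint from the face, and a large multiple
  of the distance takes the barrier below \<open>g\<close> on it.
\<close>

lemma frontier_barrier:
  fixes g :: "real^'n \<Rightarrow> real"
  assumes \<Omega>: "open \<Omega>" "bounded \<Omega>" "convex \<Omega>" and g: "continuous_on (closure \<Omega>) g"
    and g0: "\<And>x. x \<in> frontier \<Omega> \<Longrightarrow> g x = 0" and x0: "x0 \<in> frontier \<Omega>" and e: "0 < e"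
  obtains p c where "(p, c) \<in> affine_minorants (closure \<Omega>) g" "p \<bullet> x0 + c = - e"
proof -
  have ri: "rel_interior \<Omega> = \<Omega>" using \<Omega> by (simp add: rel_interior_open)
  have "x0 \<in> closure \<Omega>" "x0 \<notin> rel_interior \<Omega>"
    using x0 \<Omega> by (auto simp: frontier_def ri interior_open)
  from supporting_hyperplane_relative_frontier[OF \<Omega>(3) this] obtain a where
    a: "\<And>y. y \<in> closure \<Omega> \<Longrightarrow> a \<bullet> x0 \<le> a \<bullet> y" "\<And>y. y \<in> \<Omega> \<Longrightarrow> a \<bullet> x0 < a \<bullet> y" unfolding ri by metis
  let ?K = "closure \<Omega> \<inter> g -` {..- e}"
  have cK: "compact ?K"
  proof -
    have "closed ?K" by (intro continuous_closed_preimage g) auto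
    then show ?thesis using \<Omega>(2) by (meson bounded_closure bounded_Int compact_eq_bounded_closed)
  qed
  have pos: "a \<bullet> y - a \<bullet> x0 > 0" if "y \<in> ?K" for y
  proof -
    have "y \<notin> frontier \<Omega>" using that g0[of y] e by auto
    then have "y \<in> \<Omega>" using that \<Omega>(1) by (auto simp: frontier_def interior_open)
    then show ?thesis using a(2) by simp
  qed
  have "\<exists>M\<ge>0. \<forall>y\<in>?K. - e - M * (a \<bullet> y - a \<bullet> x0) \<le> g y"
  proof (cases "?K = {}")
    case False
    have "continuous_on ?K g" using g by (rule continuous_on_subset) auto
    moreover have "\<forall>y\<in>?K. a \<bullet> y - a \<bullet> x0 \<noteq> 0" using pos by (metis less_irrefl)
    ultimately have "continuous_on ?K (\<lambda>y. (- g y) / (a \<bullet> y - a \<bullet> x0))"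
      by (intro continuous_intros)
    from continuous_attains_sup[OF cK False this]
    obtain z where z: "z \<in> ?K" "\<And>y. y \<in> ?K \<Longrightarrow> (- g y) / (a \<bullet> y - a \<bullet> x0) \<le> (- g z) / (a \<bullet> z - a \<bullet> x0)"
      by blast
    \<comment> \<open>The maximum of this quotient over \<open>?K\<close> is steep enough to lie below \<open>g\<close> even without the \<open>- e\<close>.\<close>
    define M where "M = (- g z) / (a \<bullet> z - a \<bullet> x0)"
    have "M \<ge> 0" unfolding M_def using pos[OF z(1)] z(1) e by (intro divide_nonneg_pos) auto
    moreover have "- e - M * (a \<bullet> y - a \<bullet> x0) \<le> g y" if y: "y \<in> ?K" for y
    proof -
      have "- g y \<le> M * (a \<bullet> y - a \<bullet> x0)"
        using z(2)[OF y] unfolding M_def[symmetric] pos_divide_le_eq[OF pos[OF y]] .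
      then show ?thesis using e by linarith
    qed
    ultimately show ?thesis by blast
  qed auto
  then obtain M where M: "M \<ge> 0" "\<And>y. y \<in> ?K \<Longrightarrow> - e - M * (a \<bullet> y - a \<bullet> x0) \<le> g y" by blast
  have "- e - M * (a \<bullet> y - a \<bullet> x0) \<le> g y" if y: "y \<in> closure \<Omega>" for y
  proof (cases "y \<in> ?K")
    case False
    then have "g y > - e" using y by auto
    moreover have "M * (a \<bullet> y - a \<bullet> x0) \<ge> 0" using M(1) a(1)[OF y] by simp
    ultimately show ?thesis by linarith
  qed (use M in auto)
  then have "((- M) *\<^sub>R a, - e + M * (a \<bullet> x0)) \<in> affine_minorants (closure \<Omega>) g"
    by (auto simp: affine_minorants_def algebra_simps)
  then show thesis by (rule that) simp
qed

text \<open>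
  The envelope of a continuous function on a compact convex set can fail to be continuous at the
  frontier; zero frontier values and \<open>g \<le> 0\<close> repair this by means of the barriers.
\<close>

lemma continuous_on_convex_envelope:
  fixes g :: "real^'n \<Rightarrow> real"
  assumes \<Omega>: "open \<Omega>" "bounded \<Omega>" "convex \<Omega>" and g: "continuous_on (closure \<Omega>) g"
    and g0: "\<And>x. x \<in> frontier \<Omega> \<Longrightarrow> g x = 0" and gneg: "\<And>x. x \<in> closure \<Omega> \<Longrightarrow> g x \<le> 0"
  shows "continuous_on (closure \<Omega>) (convex_envelope (closure \<Omega>) g)"
    "\<And>x. x \<in> frontier \<Omega> \<Longrightarrow> convex_envelope (closure \<Omega>) g x = 0"
proof -
  let ?K = "closure \<Omega>" let ?v = "convex_envelope ?K g"
  have cK: "compact ?K" using \<Omega> by simp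
  have ne: "affine_minorants ?K g \<noteq> {}" by (rule affine_minorants_nonempty[OF cK g])
  have v0: "?v x \<le> 0" if "x \<in> ?K" for x
    using convex_envelope_le[OF ne that] gneg[OF that] by simp
  have low: "?v x \<ge> - e" if x: "x \<in> frontier \<Omega>" and e: "e > 0" for x e
  proof -
    obtain p c where "(p, c) \<in> affine_minorants ?K g" "p \<bullet> x + c = - e"
      using frontier_barrier[OF \<Omega> g g0 x e] by metis
    then show ?thesis using affine_minorant_le_convex_envelope[of p c ?K g x] x by (simp add: frontier_def)
  qed
  show z: "?v x = 0" if x: "x \<in> frontier \<Omega>" for x
  proof (rule antisym)
    show "?v x \<le> 0" using v0 x by (simp add: frontier_def)
    show "0 \<le> ?v x" by (rule field_le_epsilon) (use low[OF x] in force)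
  qed
  have "convex_on \<Omega> ?v"
    by (rule convex_on_subset[OF convex_on_convex_envelope[OF ne]])
      (use \<Omega> closure_subset in \<open>auto simp: convex_closure\<close>)
  then have cont: "continuous_on \<Omega> ?v" by (rule convex_on_continuous[OF \<Omega>(1)])
  show "continuous_on ?K ?v"
    unfolding continuous_on_eq_continuous_within
  proof
    fix x assume x: "x \<in> ?K"
    show "continuous (at x within ?K) ?v"
    proof (cases "x \<in> \<Omega>")
      case True
      then have "continuous (at x) ?v" using cont \<Omega>(1) by (simp add: continuous_on_eq_continuous_at)
      then show ?thesis by (rule continuous_at_imp_continuous_at_within)
    next
      case False
      then have fx: "x \<in> frontier \<Omega>" using x \<Omega>(1) by (simp add: frontier_def interior_open)
      show ?thesis
        unfolding continuous_within z[OF fx]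
      proof (rule tendstoI)
        fix e :: real assume e: "e > 0"
        obtain p c where pc: "(p, c) \<in> affine_minorants ?K g" "p \<bullet> x + c = - (e / 2)"
          using frontier_barrier[OF \<Omega> g g0 fx, of "e / 2"] e by auto
        have "((\<lambda>y. p \<bullet> y + c) \<longlongrightarrow> p \<bullet> x + c) (at x within ?K)" by (intro tendsto_intros)
        then have "\<forall>\<^sub>F y in at x within ?K. p \<bullet> y + c > - e"
          by (rule order_tendstoD) (use pc e in auto)
        moreover have "\<forall>\<^sub>F y in at x within ?K. y \<in> ?K" by (simp add: eventually_at_topological) blast
        ultimately show "\<forall>\<^sub>F y in at x within ?K. dist (?v y) 0 < e"
        proof eventually_elim
          case (elim y)
          then show ?case using affine_minorant_le_convex_envelope[OF pc(1) elim(2)] v0[OF elim(2)]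
            by (simp add: dist_real_def)
        qed
      qed
    qed
  qed
qed

section \<open>Domain monotonicity\<close>

lemma inverse_ennreal_antimono:
  fixes a b :: ennreal
  assumes "a \<le> b"
  shows "inverse b \<le> inverse a"
proof (cases "a = 0 \<or> b = top")
  case False
  obtain s where s: "b = ennreal s" "s \<ge> 0" using False by (cases b) auto
  obtain r where r: "a = ennreal r" "r \<ge> 0" using False assms s by (cases a) (auto simp: top_unique)
  have "0 < r" "r \<le> s" using False assms r s by (auto simp: less_le)
  then show ?thesis using r s by (auto simp: inverse_ennreal intro!: ennreal_leI le_imp_inverse_le)
qed auto

text \<open>
  A competitor \<open>u\<close> on the small domain is extended by zero to \<open>g\<close> and replaced by the convex envelope
  \<open>v\<close> of \<open>g\<close> on the large one. As \<open>v \<le> u \<le> 0\<close>, the denominator grows. For almost every slope the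
  touching point \<open>x\<close> of \<open>v\<close> is a touching point of \<open>g\<close> with \<open>v x = g x\<close>: it is either the touching point
  of \<open>u\<close>, with the same value, or a point with value zero. So the numerator does not grow.
\<close>

lemma ma_eigenvalue_antimono:
  fixes \<Omega>1 \<Omega>2 :: "(real^'n) set"
  assumes D1: "bounded_convex_domain \<Omega>1" and D2: "bounded_convex_domain \<Omega>2" and sub: "\<Omega>1 \<subseteq> \<Omega>2"
  shows "ma_eigenvalue \<Omega>2 \<le> ma_eigenvalue \<Omega>1"
  unfolding ma_eigenvalue_def[of \<Omega>1]
proof (rule INF_greatest)
  fix u assume "u \<in> ma_admissible \<Omega>1"
  then have u: "continuous_on (closure \<Omega>1) u" "convex_on \<Omega>1 u" "\<exists>x\<in>\<Omega>1. u x \<noteq> 0" "\<And>x. x \<in> frontier \<Omega>1 \<Longrightarrow> u x = 0"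
    by (auto simp: ma_admissible_def)
  have \<Omega>1: "open \<Omega>1" "bounded \<Omega>1" "convex \<Omega>1" "\<Omega>1 \<noteq> {}" and \<Omega>2: "open \<Omega>2" "bounded \<Omega>2" "convex \<Omega>2" "\<Omega>2 \<noteq> {}"
    using D1 D2 by (auto simp: bounded_convex_domain_def)
  have uneg: "u x \<le> 0" if "x \<in> \<Omega>1" for x
    by (rule convex_nonpos_if_zero_on_frontier[OF \<Omega>1(1,2) u(1,2,4) that])
  define g where "g x = (if x \<in> \<Omega>1 then u x else 0)" for x
  have g_u: "g x = u x" if "x \<in> closure \<Omega>1" for x
    using that u(4)[of x] \<Omega>1(1) by (auto simp: g_def frontier_def interior_open)
  have "continuous_on (closure \<Omega>1 \<union> - \<Omega>1) g"
    unfolding g_def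
    by (intro continuous_on_cases u(1)) (use \<Omega>1(1) u(4) in \<open>auto simp: frontier_def interior_open\<close>)
  moreover have "closure \<Omega>1 \<union> - \<Omega>1 = UNIV" using closure_subset by blast
  ultimately have g: "continuous_on (closure \<Omega>2) g" by (metis continuous_on_subset subset_UNIV)
  have gneg: "g x \<le> 0" for x using uneg by (simp add: g_def)
  have g0: "g x = 0" if "x \<in> frontier \<Omega>2" for x
    using that sub \<Omega>2(1) by (auto simp: g_def frontier_def interior_open)
  define v where "v = convex_envelope (closure \<Omega>2) g"
  have cK: "compact (closure \<Omega>2)" "closure \<Omega>2 \<noteq> {}" using \<Omega>2 by auto
  have ne: "affine_minorants (closure \<Omega>2) g \<noteq> {}" by (rule affine_minorants_nonempty[OF cK(1) g])
  have v_g: "v x \<le> g x" if "x \<in> closure \<Omega>2" for x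
    unfolding v_def by (rule convex_envelope_le[OF ne that])
  have cv: "continuous_on (closure \<Omega>2) v" and v0: "\<And>x. x \<in> frontier \<Omega>2 \<Longrightarrow> v x = 0"
    using continuous_on_convex_envelope[OF \<Omega>2(1-3) g g0 gneg] by (auto simp: v_def)
  have v_u: "v x \<le> u x" if "x \<in> \<Omega>1" for x
    using v_g[of x] that sub closure_subset[of \<Omega>2] by (auto simp: g_def)
  have "convex_on \<Omega>2 v"
    unfolding v_def
    by (rule convex_on_subset[OF convex_on_convex_envelope[OF ne]])
      (use \<Omega>2 closure_subset in auto)
  moreover have "\<exists>x\<in>\<Omega>2. v x \<noteq> 0"
  proof -
    obtain x where x: "x \<in> \<Omega>1" "u x \<noteq> 0" using u(3) by auto
    then have "v x < 0" using v_u[of x] uneg[of x] by linarith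
    then show ?thesis using x sub by (intro bexI[of _ x]) auto
  qed
  ultimately have adm: "v \<in> ma_admissible \<Omega>2" using cv v0 by (auto simp: ma_admissible_def)
  obtain S1 N1 where 1: "N1 \<in> null_sets lborel" "\<And>p. p \<notin> N1 \<Longrightarrow> legendre_points (closure \<Omega>1) u p = {S1 p}"
    "(\<integral>\<^sup>+x. ennreal (- u x) \<partial>monge_ampere_measure \<Omega>1 u) = (\<integral>\<^sup>+p. ennreal (- u (S1 p)) \<partial>lborel)"
    using energy_as_slope_integral[OF \<Omega>1(1,2,4) u(1,4)] by metis
  obtain S2 N2 where 2: "N2 \<in> null_sets lborel" "\<And>p. p \<notin> N2 \<Longrightarrow> legendre_points (closure \<Omega>2) v p = {S2 p}"
    "(\<integral>\<^sup>+x. ennreal (- v x) \<partial>monge_ampere_measure \<Omega>2 v) = (\<integral>\<^sup>+p. ennreal (- v (S2 p)) \<partial>lborel)"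
    using energy_as_slope_integral[OF \<Omega>2(1,2,4) cv v0] by metis
  have pt: "ennreal (- v (S2 p)) \<le> ennreal (- u (S1 p))" if p: "p \<notin> N1 \<union> N2" for p
  proof -
    obtain x where x: "x \<in> legendre_points (closure \<Omega>2) g p" using legendre_points_nonempty[OF cK g] by blast
    from legendre_points_convex_envelope[OF ne x] have vx: "v x = g x" "x = S2 p"
      using 2(2)[of p] p by (auto simp: v_def)
    show ?thesis
    proof (cases "x \<in> \<Omega>1")
      case True
      have "x \<in> legendre_points (closure \<Omega>1) u p"
        unfolding legendre_points_def
      proof (intro CollectI conjI ballI)
        show xcl: "x \<in> closure \<Omega>1" using True closure_subset by blast
        fix y assume y: "y \<in> closure \<Omega>1"
        then have "y \<in> closure \<Omega>2" using closure_mono[OF sub] by blast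
        then have "p \<bullet> y - g y \<le> p \<bullet> x - g x" using x by (simp add: legendre_points_def)
        then show "p \<bullet> y - u y \<le> p \<bullet> x - u x" by (simp only: g_u[OF y] g_u[OF xcl])
      qed
      then have "x = S1 p" using 1(2)[of p] p by auto
      then show ?thesis using vx True by (simp add: g_def)
    next
      case False
      then show ?thesis using vx by (simp add: g_def)
    qed
  qed
  have num: "(\<integral>\<^sup>+x. ennreal (- v x) \<partial>monge_ampere_measure \<Omega>2 v) \<le> (\<integral>\<^sup>+x. ennreal (- u x) \<partial>monge_ampere_measure \<Omega>1 u)"
    unfolding 1 2
  proof (rule nn_integral_mono_AE, rule AE_I')
    show "N1 \<union> N2 \<in> null_sets lborel" using 1(1) 2(1) by auto
  qed (use pt in blast)
  have den: "(\<integral>\<^sup>+x\<in>\<Omega>1. ennreal ((- u x) ^ (CARD('n) + 1)) \<partial>lborel) \<le> (\<integral>\<^sup>+x\<in>\<Omega>2. ennreal ((- v x) ^ (CARD('n) + 1)) \<partial>lborel)"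
  proof (rule nn_integral_mono)
    fix x
    show "ennreal ((- u x) ^ (CARD('n) + 1)) * indicator \<Omega>1 x \<le> ennreal ((- v x) ^ (CARD('n) + 1)) * indicator \<Omega>2 x"
    proof (cases "x \<in> \<Omega>1")
      case True
      then have "(- u x) ^ (CARD('n) + 1) \<le> (- v x) ^ (CARD('n) + 1)"
        using v_u uneg by (intro power_mono) auto
      then show ?thesis using True sub by (auto simp: ennreal_leI)
    qed simp
  qed
  have "ma_rayleigh_quotient \<Omega>2 v \<le> ma_rayleigh_quotient \<Omega>1 u"
    unfolding ma_rayleigh_quotient_def divide_ennreal_def
    using num den by (intro mult_mono) (auto intro: inverse_ennreal_antimono)
  then show "ma_eigenvalue \<Omega>2 \<le> ma_rayleigh_quotient \<Omega>1 u"
    unfolding ma_eigenvalue_def using adm by (meson INF_lower2)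
qed

section \<open>Affine transformations\<close>

lemma affine_image_domain:
  fixes A :: "real^'n^'n"
  assumes A: "invertible A" and \<Omega>: "open \<Omega>"
  shows "closure ((\<lambda>x. A *v x + b) ` \<Omega>) = (\<lambda>x. A *v x + b) ` closure \<Omega>"
    "open ((\<lambda>x. A *v x + b) ` \<Omega>)"
    "frontier ((\<lambda>x. A *v x + b) ` \<Omega>) = (\<lambda>x. A *v x + b) ` frontier \<Omega>"
proof -
  have inj: "inj ((*v) A)" and lin: "linear ((*v) A)"
    using A by (simp_all add: inj_matrix_vector_mult)
  have surj: "surj ((*v) A)" using linear_injective_imp_surjective[OF lin inj] by simp
  have T: "(\<lambda>x. A *v x + b) ` X = (+) b ` ((*v) A ` X)" for X by (auto simp: image_image add.commute)
  show c: "closure ((\<lambda>x. A *v x + b) ` \<Omega>) = (\<lambda>x. A *v x + b) ` closure \<Omega>"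
    by (simp only: T closure_translation closure_injective_linear_image[OF lin inj])
  show o: "open ((\<lambda>x. A *v x + b) ` \<Omega>)"
    unfolding T by (intro open_translation open_surjective_linear_image[OF \<Omega> lin surj])
  have "inj (\<lambda>x. A *v x + b)" using inj by (auto simp: inj_def)
  then show "frontier ((\<lambda>x. A *v x + b) ` \<Omega>) = (\<lambda>x. A *v x + b) ` frontier \<Omega>"
    using o \<Omega> by (simp add: frontier_def interior_open c image_set_diff)
qed

lemma bounded_convex_domain_affine_image:
  fixes A :: "real^'n^'n"
  assumes A: "invertible A" and \<Omega>: "bounded_convex_domain \<Omega>"
  shows "bounded_convex_domain ((\<lambda>x. A *v x + b) ` \<Omega>)"
proof -
  have T: "(\<lambda>x. A *v x + b) ` \<Omega> = (+) b ` ((*v) A ` \<Omega>)" by (auto simp: image_image add.commute)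
  show ?thesis
    using \<Omega> affine_image_domain(2)[OF A, of \<Omega> b] unfolding bounded_convex_domain_def
    by (auto simp: T intro!: bounded_translation bounded_linear_image convex_translation convex_linear_image
        matrix_vector_mul_bounded_linear)
qed

text \<open>
  Transporting \<open>u\<close> to \<open>v = u \<circ> T\<^sup>-\<^sup>1\<close> multiplies slopes by the inverse transpose of \<open>A\<close>: the energy is divided
  by \<open>|det A|\<close>, the denominator is multiplied by it.
\<close>

lemma ma_eigenvalue_affine_le:
  fixes A :: "real^'n^'n"
  assumes A: "invertible A" and D: "bounded_convex_domain \<Omega>"
  shows "ennreal (\<bar>det A\<bar>\<^sup>2) * ma_eigenvalue ((\<lambda>x. A *v x + b) ` \<Omega>) \<le> ma_eigenvalue \<Omega>"
  unfolding ma_eigenvalue_def[of \<Omega>]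
proof (rule INF_greatest)
  fix u assume "u \<in> ma_admissible \<Omega>"
  then have u: "continuous_on (closure \<Omega>) u" "convex_on \<Omega> u" "\<exists>x\<in>\<Omega>. u x \<noteq> 0" "\<And>x. x \<in> frontier \<Omega> \<Longrightarrow> u x = 0"
    by (auto simp: ma_admissible_def)
  have \<Omega>: "open \<Omega>" "bounded \<Omega>" "convex \<Omega>" "\<Omega> \<noteq> {}" using D by (auto simp: bounded_convex_domain_def)
  define T where "T = (\<lambda>x. A *v x + b)"
  obtain B where B: "A ** B = mat 1" "B ** A = mat 1" using A by (auto simp: invertible_def)
  have AB: "A *v (B *v x) = x" "B *v (A *v x) = x" for x by (simp_all add: matrix_vector_mul_assoc B)
  define T' where "T' = (\<lambda>y. B *v (y - b))"
  have TT: "T' (T x) = x" "T (T' x) = x" for x by (simp_all add: T_def T'_def AB)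
  define v where "v = u \<circ> T'"
  have vT: "v (T x) = u x" for x by (simp add: v_def TT)
  have D': "bounded_convex_domain (T ` \<Omega>)" unfolding T_def by (rule bounded_convex_domain_affine_image[OF A D])
  then have \<Omega>': "open (T ` \<Omega>)" "bounded (T ` \<Omega>)" "convex (T ` \<Omega>)" "T ` \<Omega> \<noteq> {}" by (auto simp: bounded_convex_domain_def)
  have cl: "closure (T ` \<Omega>) = T ` closure \<Omega>" and fr: "frontier (T ` \<Omega>) = T ` frontier \<Omega>"
    unfolding T_def by (rule affine_image_domain[OF A \<Omega>(1)])+
  have cT': "continuous_on X T'" for X
    unfolding T'_def by (intro continuous_on_compose2[OF matrix_vector_mult_linear_continuous_on[of UNIV B]] continuous_intros) auto
  have cv: "continuous_on (closure (T ` \<Omega>)) v"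
    unfolding v_def cl by (rule continuous_on_compose[OF cT']) (simp add: image_image TT u(1))
  have v0: "v x = 0" if "x \<in> frontier (T ` \<Omega>)" for x using that u(4) by (auto simp: fr vT)
  have "convex_on (T ` \<Omega>) v"
  proof (rule convex_onI)
    fix t x y assume t: "0 < t" "t < (1::real)" and xy: "x \<in> T ` \<Omega>" "y \<in> T ` \<Omega>"
    have "(1 - t) *\<^sub>R x + t *\<^sub>R y - b = (1 - t) *\<^sub>R (x - b) + t *\<^sub>R (y - b)" by (simp add: algebra_simps)
    then have "T' ((1 - t) *\<^sub>R x + t *\<^sub>R y) = (1 - t) *\<^sub>R T' x + t *\<^sub>R T' y"
      unfolding T'_def by (simp only: matrix_vector_right_distrib matrix_vector_mult_scaleR)
    moreover have "T' x \<in> \<Omega>" "T' y \<in> \<Omega>" using xy by (auto simp: TT)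
    ultimately show "v ((1 - t) *\<^sub>R x + t *\<^sub>R y) \<le> (1 - t) * v x + t * v y"
      using convex_onD[OF u(2), of t "T' x" "T' y"] t by (simp add: v_def)
  qed (fact \<Omega>')
  then have adm: "v \<in> ma_admissible (T ` \<Omega>)" using cv v0 u(3) by (auto simp: ma_admissible_def vT)
  obtain S N where 1: "N \<in> null_sets lborel" "\<And>p. p \<notin> N \<Longrightarrow> legendre_points (closure \<Omega>) u p = {S p}"
    "(\<lambda>p. ennreal (- u (S p))) \<in> borel_measurable borel"
    "(\<integral>\<^sup>+x. ennreal (- u x) \<partial>monge_ampere_measure \<Omega> u) = (\<integral>\<^sup>+p. ennreal (- u (S p)) \<partial>lborel)"
    using energy_as_slope_integral[OF \<Omega>(1,2,4) u(1,4)] by metis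
  obtain S' N' where 2: "N' \<in> null_sets lborel" "\<And>p. p \<notin> N' \<Longrightarrow> legendre_points (closure (T ` \<Omega>)) v p = {S' p}"
    "(\<integral>\<^sup>+x. ennreal (- v x) \<partial>monge_ampere_measure (T ` \<Omega>) v) = (\<integral>\<^sup>+p. ennreal (- v (S' p)) \<partial>lborel)"
    using energy_as_slope_integral[OF \<Omega>'(1,2,4) cv v0] by metis
  let ?A = "transpose A"
  have tA: "invertible ?A" "det ?A = det A" using A by (simp_all add: det_transpose transpose_invertible)
  have dot: "q \<bullet> T x = (?A *v q) \<bullet> x + q \<bullet> b" for q x
    by (simp add: T_def inner_add_right transpose_matrix_vector dot_lmul_matrix)
  have pt: "ennreal (- v (S' q)) = ennreal (- u (S (?A *v q + 0)))" if q: "q \<notin> N' \<union> (*v) ?A -` N" for q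
  proof -
    have "S (?A *v q) \<in> legendre_points (closure \<Omega>) u (?A *v q)" using 1(2)[of "?A *v q"] q by auto
    then have "T (S (?A *v q)) \<in> legendre_points (closure (T ` \<Omega>)) v q"
      by (auto simp: legendre_points_def cl dot vT)
    then have "T (S (?A *v q)) = S' q" using 2(2)[of q] q by auto
    then show ?thesis using vT[of "S (?A *v q)"] by simp
  qed
  define \<delta> where "\<delta> = ennreal \<bar>det A\<bar>"
  have \<delta>: "\<delta> \<noteq> 0" "\<delta> \<noteq> top" using A by (auto simp: \<delta>_def invertible_det_nz)
  have null: "N' \<union> (*v) ?A -` N \<in> null_sets lborel" by (rule null_sets.Un[OF 2(1) linear_preimage_null_set[OF tA(1) 1(1)]])
  have "(\<integral>\<^sup>+q. ennreal (- v (S' q)) \<partial>lborel) = (\<integral>\<^sup>+q. ennreal (- u (S (?A *v q + 0))) \<partial>lborel)"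
    by (rule nn_integral_cong_AE, rule AE_I'[OF null]) (use pt in blast)
  then have num: "\<delta> * (\<integral>\<^sup>+x. ennreal (- v x) \<partial>monge_ampere_measure (T ` \<Omega>) v) = (\<integral>\<^sup>+x. ennreal (- u x) \<partial>monge_ampere_measure \<Omega> u)"
    unfolding 1(4) 2(3) \<delta>_def
    using nn_integral_affine_substitution[OF tA(1) 1(3), of 0] tA(2) by simp
  have meas: "(\<lambda>y. ennreal ((- v y) ^ (CARD('n) + 1)) * indicator (T ` \<Omega>) y) \<in> borel_measurable borel"
    by (intro measurable_cut_off \<Omega>'(1) continuous_intros continuous_on_subset[OF cv] closure_subset)
  have ind: "indicator (T ` \<Omega>) (T x) = indicator \<Omega> x" for x
    using TT(1) by (auto simp: indicator_def image_iff) (metis TT(1))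
  have den: "(\<integral>\<^sup>+y\<in>T ` \<Omega>. ennreal ((- v y) ^ (CARD('n) + 1)) \<partial>lborel) = \<delta> * (\<integral>\<^sup>+x\<in>\<Omega>. ennreal ((- u x) ^ (CARD('n) + 1)) \<partial>lborel)"
    using nn_integral_affine_substitution[OF A meas, of b] unfolding \<delta>_def by (simp add: vT ind flip: T_def[THEN fun_cong])
  have canc: "\<delta> * inverse (\<delta> * d) = inverse d" for d
  proof -
    have "\<delta> * inverse \<delta> = 1"
      using \<delta> ennreal_divide_self[of \<delta>] by (simp add: divide_ennreal_def less_top zero_less_iff_neq_zero)
    moreover have "inverse (\<delta> * d) = inverse \<delta> * inverse d"
      using \<delta> by (intro ennreal_inverse_mult') (auto simp: less_top zero_less_iff_neq_zero)
    ultimately show ?thesis by (simp flip: mult.assoc)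
  qed
  have "\<delta> * \<delta> * ma_rayleigh_quotient (T ` \<Omega>) v = ma_rayleigh_quotient \<Omega> u"
    unfolding ma_rayleigh_quotient_def divide_ennreal_def den num[symmetric]
    by (subst canc[symmetric]) (simp add: mult_ac)
  moreover have "\<delta> * \<delta> = ennreal (\<bar>det A\<bar>\<^sup>2)" by (simp add: \<delta>_def power2_eq_square flip: ennreal_mult)
  moreover have "ma_eigenvalue (T ` \<Omega>) \<le> ma_rayleigh_quotient (T ` \<Omega>) v"
    unfolding ma_eigenvalue_def using adm by (rule INF_lower)
  ultimately show "ennreal (\<bar>det A\<bar>\<^sup>2) * ma_eigenvalue ((\<lambda>x. A *v x + b) ` \<Omega>) \<le> ma_rayleigh_quotient \<Omega> u"
    unfolding T_def[symmetric] by (metis mult_left_mono zero_le)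
qed

text \<open>
  The opposite inequality is the previous one for the inverse transformation.
\<close>

lemma ma_eigenvalue_affine:
  fixes A :: "real^'n^'n"
  assumes A: "invertible A" and D: "bounded_convex_domain \<Omega>"
  shows "ma_eigenvalue ((\<lambda>x. A *v x + b) ` \<Omega>) = ennreal (\<bar>det A\<bar> powi (-2)) * ma_eigenvalue \<Omega>"
proof -
  let ?T = "\<lambda>x. A *v x + b"
  obtain B where B: "A ** B = mat 1" "B ** A = mat 1" using A by (auto simp: invertible_def)
  have AB: "B *v (A *v x) = x" for x by (simp add: matrix_vector_mul_assoc B)
  have iB: "invertible B" using B by (auto simp: invertible_def)
  have d: "det A * det B = 1" using B(1) by (metis det_I det_mul)
  have inv: "(\<lambda>y. B *v y + - (B *v b)) ` (?T ` \<Omega>) = \<Omega>"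
    by (simp add: image_image matrix_vector_right_distrib AB)
  have nz: "det A \<noteq> 0" using d by auto
  have sq: "\<bar>det B\<bar>\<^sup>2 = \<bar>det A\<bar> powi (-2)"
  proof -
    have "\<bar>det B\<bar> = inverse \<bar>det A\<bar>" using d nz by (simp add: field_simps flip: abs_mult)
    then show ?thesis by (simp add: power_int_minus power_inverse)
  qed
  have one: "ennreal (\<bar>det A\<bar> powi (-2)) * ennreal (\<bar>det A\<bar>\<^sup>2) = 1"
    using nz by (simp add: power_int_minus flip: ennreal_mult)
  have "ennreal (\<bar>det B\<bar>\<^sup>2) * ma_eigenvalue \<Omega> \<le> ma_eigenvalue (?T ` \<Omega>)"
    using ma_eigenvalue_affine_le[OF iB bounded_convex_domain_affine_image[OF A D], of "- (B *v b)" b] unfolding inv .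
  moreover have "ma_eigenvalue (?T ` \<Omega>) \<le> ennreal (\<bar>det A\<bar> powi (-2)) * ma_eigenvalue \<Omega>"
    using mult_left_mono[OF ma_eigenvalue_affine_le[OF A D, of b] zero_le, of "ennreal (\<bar>det A\<bar> powi (-2))"]
    by (simp only: mult.assoc[symmetric] one mult_1)
  ultimately show ?thesis unfolding sq by (rule antisym[rotated])
qed

lemma dilation_as_affine_map:
  fixes c :: "real^'n"
  assumes t: "t > 0"
  obtains A :: "real^'n^'n" where "invertible A" "\<bar>det A\<bar> powi (-2) = t powi (- 2 * int CARD('n))"
    "\<And>x. A *v x = t *\<^sub>R x"
proof -
  let ?A = "matrix ((*\<^sub>R) t) :: real^'n^'n"
  have "det ?A = t ^ CARD('n)" by (rule det_matrix_scaleR)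
  then have "invertible ?A" "\<bar>det ?A\<bar> powi (-2) = t powi (- 2 * int CARD('n))"
    using t by (auto simp: invertible_det_nz power_int_minus power_int_mult power_mult[symmetric] mult.commute)
  moreover have "?A *v x = t *\<^sub>R x" for x
    by (metis linear_scaleR matrix_vector_mul)
  ultimately show thesis using that by blast
qed

lemma ma_eigenvalue_dilation:
  fixes c :: "real^'n"
  assumes D: "bounded_convex_domain \<Omega>" and t: "t > 0"
  shows "ma_eigenvalue ((\<lambda>x. c + t *\<^sub>R (x - c)) ` \<Omega>) = ennreal (t powi (- 2 * int CARD('n))) * ma_eigenvalue \<Omega>"
    "bounded_convex_domain ((\<lambda>x. c + t *\<^sub>R (x - c)) ` \<Omega>)"
proof -
  obtain A :: "real^'n^'n" where A: "invertible A" "\<bar>det A\<bar> powi (-2) = t powi (- 2 * int CARD('n))"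
    "\<And>x. A *v x = t *\<^sub>R x" using dilation_as_affine_map[OF t] by metis
  have eq: "(\<lambda>x. c + t *\<^sub>R (x - c)) = (\<lambda>x. A *v x + (c - t *\<^sub>R c))" by (auto simp: A(3) algebra_simps)
  show "ma_eigenvalue ((\<lambda>x. c + t *\<^sub>R (x - c)) ` \<Omega>) = ennreal (t powi (- 2 * int CARD('n))) * ma_eigenvalue \<Omega>"
    unfolding eq ma_eigenvalue_affine[OF A(1) D] A(2) ..
  show "bounded_convex_domain ((\<lambda>x. c + t *\<^sub>R (x - c)) ` \<Omega>)"
    unfolding eq by (rule bounded_convex_domain_affine_image[OF A(1) D])
qed

section \<open>Stability under Hausdorff convergence\<close>

lemma infdist_le_hausdorff_distance:
  assumes "bounded A" "bounded B" "A \<noteq> {}" "B \<noteq> {}"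
  shows "x \<in> A \<Longrightarrow> infdist x B \<le> hausdorff_distance A B" "y \<in> B \<Longrightarrow> infdist y A \<le> hausdorff_distance A B"
proof -
  have bdd: "bdd_above ((\<lambda>x. infdist x Y) ` X)" if XY: "bounded X" "Y \<noteq> {}" for X Y :: "'a set"
  proof -
    obtain y where y: "y \<in> Y" using XY by auto
    obtain e where "\<And>x. x \<in> X \<Longrightarrow> dist y x \<le> e" using XY(1) unfolding bounded_any_center[where a = y] by auto
    then have "infdist x Y \<le> e" if "x \<in> X" for x
      using that y by (intro infdist_le2[OF y]) (auto simp: dist_commute)
    then show ?thesis by (intro bdd_aboveI[of _ e]) auto
  qed
  show "x \<in> A \<Longrightarrow> infdist x B \<le> hausdorff_distance A B"
    unfolding hausdorff_distance_def by (intro max.coboundedI1 cSUP_upper bdd assms)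
  show "y \<in> B \<Longrightarrow> infdist y A \<le> hausdorff_distance A B"
    unfolding hausdorff_distance_def by (intro max.coboundedI2 cSUP_upper bdd assms)
qed

lemma infdist_less_witness:
  assumes "A \<noteq> {}" "infdist x A < d"
  obtains y where "y \<in> A" "dist x y < d"
  using assms by (auto simp: infdist_notempty cINF_less_iff)

text \<open>
  A point of \<open>\<Omega>'\<close> differs from some point of \<open>\<Omega>\<close> by \<open>\<epsilon>\<close> times a vector shorter than \<open>r\<close>, and
  \<open>\<Omega>\<close> contains the ball of radius \<open>r\<close> about \<open>c\<close>, which absorbs this vector.
\<close>

lemma subset_dilation_if_hausdorff_close:
  fixes \<Omega> :: "(real^'n) set"
  assumes \<Omega>: "bounded \<Omega>" "convex \<Omega>" and \<Omega>': "bounded \<Omega>'" "\<Omega>' \<noteq> {}"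
    and ball: "ball c r \<subseteq> \<Omega>" "r > 0" and e: "\<epsilon> > 0" and close: "hausdorff_distance \<Omega>' \<Omega> < \<epsilon> * r"
  shows "\<Omega>' \<subseteq> (\<lambda>x. c + (1 + \<epsilon>) *\<^sub>R (x - c)) ` \<Omega>"
proof
  fix x assume x: "x \<in> \<Omega>'"
  have ne: "\<Omega> \<noteq> {}" using ball by auto
  have "infdist x \<Omega> < \<epsilon> * r"
    using infdist_le_hausdorff_distance(1)[OF \<Omega>'(1) \<Omega>(1) \<Omega>'(2) ne x] close by simp
  then obtain y where y: "y \<in> \<Omega>" "dist x y < \<epsilon> * r" using infdist_less_witness[OF ne] by metis
  define z where "z = c + (1 / \<epsilon>) *\<^sub>R (x - y)"
  have "dist z c = dist x y / \<epsilon>" using e by (simp add: z_def dist_norm del: scaleR_right_diff_distrib)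
  then have "dist c z < r" using y(2) e by (simp add: dist_commute[of c] pos_divide_less_eq mult.commute)
  then have z: "z \<in> \<Omega>" using ball by auto
  define w where "w = (1 / (1 + \<epsilon>)) *\<^sub>R y + (\<epsilon> / (1 + \<epsilon>)) *\<^sub>R z"
  have "w \<in> \<Omega>" unfolding w_def using e by (intro convexD[OF \<Omega>(2) y(1) z]) (auto simp: field_simps)
  moreover have "(1 + \<epsilon>) *\<^sub>R w = y + \<epsilon> *\<^sub>R z" using e by (simp add: w_def scaleR_add_right)
  then have "x = c + (1 + \<epsilon>) *\<^sub>R (w - c)" using e by (simp add: z_def algebra_simps)
  ultimately show "x \<in> (\<lambda>x. c + (1 + \<epsilon>) *\<^sub>R (x - c)) ` \<Omega>" by blast
qed

text \<open>
  Around each point \<open>x\<close> of the shrunken domain, \<open>\<Omega>\<close> still contains the ball of radius \<open>\<epsilon> * r\<close>. If \<open>x\<close>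
  were outside the convex set \<open>\<Omega>'\<close>, walking from \<open>x\<close> away from a separating hyperplane by a length between
  the Hausdorff distance and \<open>\<epsilon> * r\<close> would reach a point of \<open>\<Omega>\<close> too far from \<open>\<Omega>'\<close>.
\<close>

lemma dilation_subset_if_hausdorff_close:
  fixes \<Omega> :: "(real^'n) set"
  assumes \<Omega>: "bounded \<Omega>" "convex \<Omega>" and \<Omega>': "bounded \<Omega>'" "convex \<Omega>'" "\<Omega>' \<noteq> {}"
    and ball: "ball c r \<subseteq> \<Omega>" "r > 0" and e: "0 < \<epsilon>" "\<epsilon> < 1" and close: "hausdorff_distance \<Omega>' \<Omega> < \<epsilon> * r"
  shows "(\<lambda>x. c + (1 - \<epsilon>) *\<^sub>R (x - c)) ` \<Omega> \<subseteq> \<Omega>'"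
proof (rule ccontr)
  let ?h = "hausdorff_distance \<Omega>' \<Omega>"
  assume "\<not> ?thesis"
  then obtain w where w: "w \<in> \<Omega>" "c + (1 - \<epsilon>) *\<^sub>R (w - c) \<notin> \<Omega>'" by auto
  define x where "x = c + (1 - \<epsilon>) *\<^sub>R (w - c)"
  have "\<Omega>' \<inter> {x} = {}" using w by (auto simp: x_def)
  then obtain a b where ab: "a \<noteq> 0" "\<And>y. y \<in> \<Omega>' \<Longrightarrow> a \<bullet> y \<le> b" "b \<le> a \<bullet> x"
    using separating_hyperplane_sets[OF \<Omega>'(2) convex_singleton \<Omega>'(3), of x] by auto
  have ne: "\<Omega> \<noteq> {}" using ball by auto
  note near = infdist_le_hausdorff_distance(2)[OF \<Omega>'(1) \<Omega>(1) \<Omega>'(3) ne]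
  have h0: "?h \<ge> 0" using near[OF w(1)] infdist_nonneg[of w \<Omega>'] by linarith
  have "?h / \<epsilon> < r" using close e by (simp add: field_simps)
  then obtain s where hs: "?h / \<epsilon> < s" and sr: "s < r" using dense by blast
  have s: "?h < \<epsilon> * s" "s < r" "0 < s"
  proof -
    show "?h < \<epsilon> * s" using hs e by (simp add: field_simps)
    have "0 \<le> ?h / \<epsilon>" using h0 e by simp
    then show "0 < s" using hs by linarith
  qed (fact sr)
  define z where "z = (1 - \<epsilon>) *\<^sub>R w + \<epsilon> *\<^sub>R (c + s *\<^sub>R sgn a)"
  have "dist c (c + s *\<^sub>R sgn a) < r" using s ab(1) by (simp add: dist_norm norm_sgn)
  then have "c + s *\<^sub>R sgn a \<in> \<Omega>" using ball by auto
  then have z: "z \<in> \<Omega>" unfolding z_def using e by (intro convexD[OF \<Omega>(2) w(1)]) auto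
  have "infdist z \<Omega>' < \<epsilon> * s" using near[OF z] s by linarith
  then obtain y where y: "y \<in> \<Omega>'" "dist z y < \<epsilon> * s" using infdist_less_witness[OF \<Omega>'(3)] by metis
  have zx: "z - x = (\<epsilon> * s) *\<^sub>R sgn a" by (simp add: z_def x_def algebra_simps)
  have "a \<bullet> sgn a = norm a" using ab(1) by (simp add: sgn_div_norm power2_norm_eq_inner[symmetric] power2_eq_square)
  then have "(\<epsilon> * s) * norm a = a \<bullet> (z - x)" by (simp add: zx)
  also have "\<dots> \<le> a \<bullet> (z - y)" using ab(2)[OF y(1)] ab(3) by (simp add: inner_diff_right)
  also have "\<dots> \<le> norm a * dist z y" by (simp add: dist_norm norm_cauchy_schwarz)
  also have "\<dots> < norm a * (\<epsilon> * s)" using y(2) ab(1) by simp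
  finally show False by (simp add: mult.commute)
qed

text \<open>
  The domains \<open>\<Omega>m m\<close> are squeezed between dilations of \<open>\<Omega>\<close> with factors tending to \<open>1\<close>, so the
  eigenvalues are squeezed by monotonicity and scaling.
\<close>

lemma ma_eigenvalue_hausdorff_limit:
  fixes \<Omega> :: "(real^'n) set"
  assumes Dm: "\<And>m. bounded_convex_domain (\<Omega>m m)" and D: "bounded_convex_domain \<Omega>"
    and lim: "(\<lambda>m. hausdorff_distance (\<Omega>m m) \<Omega>) \<longlonglongrightarrow> 0"
  shows "(\<lambda>m. ma_eigenvalue (\<Omega>m m)) \<longlonglongrightarrow> ma_eigenvalue \<Omega>"
proof -
  let ?h = "\<lambda>m. hausdorff_distance (\<Omega>m m) \<Omega>" and ?\<Lambda> = "ma_eigenvalue \<Omega>"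
  have \<Omega>: "open \<Omega>" "bounded \<Omega>" "convex \<Omega>" "\<Omega> \<noteq> {}" using D by (auto simp: bounded_convex_domain_def)
  have \<Omega>m: "bounded (\<Omega>m m)" "convex (\<Omega>m m)" "\<Omega>m m \<noteq> {}" for m using Dm[of m] by (auto simp: bounded_convex_domain_def)
  obtain c where "c \<in> \<Omega>" using \<Omega> by auto
  then obtain r where r: "r > 0" "ball c r \<subseteq> \<Omega>" using \<Omega>(1) open_contains_ball by metis
  \<comment> \<open>The second summand makes \<open>\<epsilon> m\<close> positive and the distance strictly smaller than \<open>\<epsilon> m * r\<close>.\<close>
  define \<epsilon> where "\<epsilon> m = \<bar>?h m\<bar> / r + inverse (real (Suc m))" for m
  define \<phi> where "\<phi> t = ennreal (t powi (- 2 * int CARD('n))) * ?\<Lambda>" for t :: real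
  have "\<epsilon> \<longlonglongrightarrow> 0 / r + 0"
    unfolding \<epsilon>_def by (intro tendsto_intros tendsto_rabs_zero lim LIMSEQ_inverse_real_of_nat) (use r in auto)
  then have \<epsilon>0: "\<epsilon> \<longlonglongrightarrow> 0" by simp
  have \<epsilon>pos: "\<epsilon> m > 0" for m using r by (simp add: \<epsilon>_def add_nonneg_pos)
  have close: "?h m < \<epsilon> m * r" for m
  proof -
    have "\<epsilon> m * r = \<bar>?h m\<bar> + inverse (real (Suc m)) * r" using r by (simp add: \<epsilon>_def distrib_right)
    moreover have "inverse (real (Suc m)) * r > 0" using r by simp
    ultimately show ?thesis by linarith
  qed
  have lower: "\<phi> (1 + \<epsilon> m) \<le> ma_eigenvalue (\<Omega>m m)" for m
    using ma_eigenvalue_antimono[OF Dm ma_eigenvalue_dilation(2)[OF D, of "1 + \<epsilon> m"] 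
        subset_dilation_if_hausdorff_close[OF \<Omega>(2,3) \<Omega>m(1,3) r(2,1) \<epsilon>pos close]] \<epsilon>pos[of m]
    by (simp add: ma_eigenvalue_dilation(1)[OF D] \<phi>_def)
  have upper: "ma_eigenvalue (\<Omega>m m) \<le> \<phi> (1 - \<epsilon> m)" if "\<epsilon> m < 1" for m
    using ma_eigenvalue_antimono[OF ma_eigenvalue_dilation(2)[OF D, of "1 - \<epsilon> m"] Dm
        dilation_subset_if_hausdorff_close[OF \<Omega>(2,3) \<Omega>m r(2,1) \<epsilon>pos that close]] that
    by (simp add: ma_eigenvalue_dilation(1)[OF D] \<phi>_def)
  have \<phi>: "(\<lambda>m. \<phi> (f m)) \<longlonglongrightarrow> ?\<Lambda>" if f: "f \<longlonglongrightarrow> 1" for f :: "nat \<Rightarrow> real"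
  proof -
    have "(\<lambda>m. f m powi (- 2 * int CARD('n))) \<longlonglongrightarrow> 1 powi (- 2 * int CARD('n))"
      by (intro tendsto_power_int f) auto
    then have "(\<lambda>m. ennreal (f m powi (- 2 * int CARD('n)))) \<longlonglongrightarrow> ennreal 1"
      by (intro tendsto_ennrealI) simp
    then have "(\<lambda>m. \<phi> (f m)) \<longlonglongrightarrow> ennreal 1 * ?\<Lambda>"
      unfolding \<phi>_def by (intro tendsto_mult_ennreal tendsto_const) auto
    then show ?thesis by simp
  qed
  show ?thesis
  proof (rule tendsto_sandwich)
    show "\<forall>\<^sub>F m in sequentially. \<phi> (1 + \<epsilon> m) \<le> ma_eigenvalue (\<Omega>m m)" using lower by simp
    have "\<forall>\<^sub>F m in sequentially. \<epsilon> m < 1" using order_tendstoD(2)[OF \<epsilon>0] by simp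
    then show "\<forall>\<^sub>F m in sequentially. ma_eigenvalue (\<Omega>m m) \<le> \<phi> (1 - \<epsilon> m)"
      by eventually_elim (rule upper)
    show "(\<lambda>m. \<phi> (1 + \<epsilon> m)) \<longlonglongrightarrow> ?\<Lambda>" by (rule \<phi>) (use tendsto_add[OF tendsto_const \<epsilon>0, of 1] in simp)
    show "(\<lambda>m. \<phi> (1 - \<epsilon> m)) \<longlonglongrightarrow> ?\<Lambda>" by (rule \<phi>) (use tendsto_diff[OF tendsto_const \<epsilon>0, of 1] in simp)
  qed
qed

theorem proposition5p8:
  assumes "CARD('n::finite) \<ge> 2"
  shows "(\<forall>(\<Omega>m :: nat \<Rightarrow> (real ^ 'n) set) \<Omega>.
           (\<forall>m. bounded_convex_domain (\<Omega>m m)) \<and> bounded_convex_domain \<Omega> \<and>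
           (\<lambda>m. hausdorff_distance (\<Omega>m m) \<Omega>) \<longlonglongrightarrow> 0 \<longrightarrow>
           (\<lambda>m. ma_eigenvalue (\<Omega>m m)) \<longlonglongrightarrow> ma_eigenvalue \<Omega>) \<and>
         (\<forall>\<Omega>1 \<Omega>2 :: (real ^ 'n) set.
           bounded_convex_domain \<Omega>1 \<and> bounded_convex_domain \<Omega>2 \<and> \<Omega>1 \<subseteq> \<Omega>2 \<longrightarrow>
           ma_eigenvalue \<Omega>2 \<le> ma_eigenvalue \<Omega>1) \<and>
         (\<forall>(\<Omega> :: (real ^ 'n) set) (A :: real ^ 'n ^ 'n) b.
           bounded_convex_domain \<Omega> \<and> invertible A \<longrightarrow>
           ma_eigenvalue ((\<lambda>x. A *v x + b) ` \<Omega>) =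
             ennreal (\<bar>det A\<bar> powi (-2)) * ma_eigenvalue \<Omega>) \<and>
         (\<forall>(\<Omega> :: (real ^ 'n) set) t::real.
           bounded_convex_domain \<Omega> \<and> t > 0 \<longrightarrow>
           ma_eigenvalue ((\<lambda>x. t *\<^sub>R x) ` \<Omega>) =
             ennreal (t powi (- 2 * int CARD('n))) * ma_eigenvalue \<Omega>) \<and>
         (\<forall>(\<Omega> :: (real ^ 'n) set) (A :: real ^ 'n ^ 'n) b.
           bounded_convex_domain \<Omega> \<and> det A = 1 \<longrightarrow>
           ma_eigenvalue ((\<lambda>x. A *v x + b) ` \<Omega>) = ma_eigenvalue \<Omega>)"
proof (intro conjI allI impI; elim conjE)
  fix \<Omega>m :: "nat \<Rightarrow> (real ^ 'n) set" and \<Omega>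
  assume "\<forall>m. bounded_convex_domain (\<Omega>m m)" "bounded_convex_domain \<Omega>"
    "(\<lambda>m. hausdorff_distance (\<Omega>m m) \<Omega>) \<longlonglongrightarrow> 0"
  then show "(\<lambda>m. ma_eigenvalue (\<Omega>m m)) \<longlonglongrightarrow> ma_eigenvalue \<Omega>"
    by (intro ma_eigenvalue_hausdorff_limit) auto
next
  fix \<Omega>1 \<Omega>2 :: "(real ^ 'n) set"
  assume "bounded_convex_domain \<Omega>1" "bounded_convex_domain \<Omega>2" "\<Omega>1 \<subseteq> \<Omega>2"
  then show "ma_eigenvalue \<Omega>2 \<le> ma_eigenvalue \<Omega>1" by (rule ma_eigenvalue_antimono)
next
  fix \<Omega> :: "(real ^ 'n) set" and A :: "real ^ 'n ^ 'n" and b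
  assume "bounded_convex_domain \<Omega>" "invertible A"
  then show "ma_eigenvalue ((\<lambda>x. A *v x + b) ` \<Omega>) = ennreal (\<bar>det A\<bar> powi (-2)) * ma_eigenvalue \<Omega>"
    by (intro ma_eigenvalue_affine)
next
  fix \<Omega> :: "(real ^ 'n) set" and t :: real
  assume "bounded_convex_domain \<Omega>" "t > 0"
  then show "ma_eigenvalue ((\<lambda>x. t *\<^sub>R x) ` \<Omega>) = ennreal (t powi (- 2 * int CARD('n))) * ma_eigenvalue \<Omega>"
    using ma_eigenvalue_dilation(1)[of \<Omega> t 0] by simp
next
  fix \<Omega> :: "(real ^ 'n) set" and A :: "real ^ 'n ^ 'n" and b
  assume "bounded_convex_domain \<Omega>" "det A = 1"
  then show "ma_eigenvalue ((\<lambda>x. A *v x + b) ` \<Omega>) = ma_eigenvalue \<Omega>"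
    using ma_eigenvalue_affine[of A \<Omega> b] by (simp add: invertible_det_nz)
qed

end
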